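(* Every misère impartial game born by day $6$ (that is, every game $G$ with $\mathrm b(G)\le 6$) has the unique partition property.
   Context: A (misère impartial) game is a hereditarily finite set; its elements are called its options. $0=\{\}$, $1=\{0\}$. The sum is $G+H=\{G'+H: G'\in G\}\cup\{G+H':H'\in H\}$. Misère outcome: $G$ is a $\mathscr{P}$-position if $G$ is nonempty and every option of $G$ is an $\mathscr{N}$-position; otherwise $G$ is an $\mathscr{N}$-position. $G=H$ means that $G+X$ and $H+X$ have the same misère outcome for every game $X$. The formal birthday is $\tilde{\mathrm b}(0)=0$, $\tilde{\mathrm b}(G)=\max\{\tilde{\mathrm b}(G')+1:G'\in G\}$, and the birthday is $\mathrm b(G)=\min\{\tilde{\mathrm b}(H):H=G\}$. A unit is a game $U$ such that $U+V=0$ for some game $V$. $G\approx H$ ($G$ and $H$ are associates) means $G=H+U$ for some unit $U$. $H$ is a part of $G$ if $G=H+X$ for some $X$; the part $H$ is proper if $H\not\approx0$ and $H\not\approx G$. $G$ is prime if it is not a unit and has no proper parts. A prime partition of $G$ is an expression of $G$, up to a unit, as a sum $P_1+\cdots+P_k$ of primes (with $k=0$ when $G$ is a unit); two prime partitions are the same up to association if, after reordering, corresponding primes are associates. $G$ has the unique partition property (UPP) if $G$ has exactly one prime partition up to association. *)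

theory Defs
  imports "HOL-Library.FSet" "HOL-Library.Multiset"
begin

text \<open>Games are literally the hereditarily finite sets, so \<^term>\<open>(=)\<close> on the type is identity of
  sets; the equality of games modulo misere outcomes is \<open>game_eq\<close> below.\<close>

datatype game = Game (options: "game fset")

lemma size_option_less: "x |\<in>| A \<Longrightarrow> size x < size (Game A)"
  by (induction A) auto

instantiation game :: "{zero, plus}"
begin

definition zero_game :: game where "zero_game = Game {||}"

function plus_game :: "game \<Rightarrow> game \<Rightarrow> game" where
  "plus_game (Game A) (Game B) =
     Game ((\<lambda>x. plus_game x (Game B)) |`| A |\<union>| (\<lambda>y. plus_game (Game A) y) |`| B)"
  by pat_completeness auto
termination
  by (relation "measure (\<lambda>(G, H). size G + size H)") (auto dest: size_option_less)

instance ..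

end

lemma options_plus:
  "options (G + H) = (\<lambda>x. x + H) |`| options G |\<union>| (\<lambda>y. G + y) |`| options H"
  by (cases G; cases H) simp

lemma options_zero [simp]: "options 0 = {||}"
  by (simp add: zero_game_def)

lemma size_options_less: "x |\<in>| options G \<Longrightarrow> size x < size G"
  using size_option_less by (cases G) auto

instance game :: comm_monoid_add
proof
  show "a + b + c = a + (b + c)" for a b c :: game
  proof (induction "size a + size b + size c" arbitrary: a b c rule: less_induct)
    case less
    have "x + b + c = x + (b + c)" if "x |\<in>| options a" for x
      using less[of x b c] size_options_less[OF that] by simp
    moreover have "a + x + c = a + (x + c)" if "x |\<in>| options b" for x
      using less[of a x c] size_options_less[OF that] by simp
    moreover have "a + b + x = a + (b + x)" if "x |\<in>| options c" for x
      using less[of a b x] size_options_less[OF that] by simp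
    ultimately have "options (a + b + c) = options (a + (b + c))"
      by (auto simp: options_plus fimage_funion image_iff)
    then show ?case by (rule game.expand)
  qed
  show "a + b = b + a" for a b :: game
  proof (induction "size a + size b" arbitrary: a b rule: less_induct)
    case less
    have "x + b = b + x" if "x |\<in>| options a" for x
      using less[of x b] size_options_less[OF that] by simp
    moreover have "a + x = x + a" if "x |\<in>| options b" for x
      using less[of a x] size_options_less[OF that] by simp
    ultimately have "options (a + b) = options (b + a)"
      by (auto simp: options_plus image_iff)
    then show ?case by (rule game.expand)
  qed
  show "0 + a = a" for a :: game
  proof (induction "size a" arbitrary: a rule: less_induct)
    case less
    have "0 + x = x" if "x |\<in>| options a" for x
      using less[of x] size_options_less[OF that] by simp
    then have "options (0 + a) = options a"
      by (auto simp: options_plus image_iff)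
    then show ?case by (rule game.expand)
  qed
qed

text \<open>The misere outcome: \<open>P_position G\<close> says that \<open>G\<close> is a \<open>\<P>\<close>-position; all other games are
  \<open>\<N>\<close>-positions.\<close>

function P_position :: "game \<Rightarrow> bool" where
  "P_position (Game A) \<longleftrightarrow> A \<noteq> {||} \<and> (\<forall>x. x |\<in>| A \<longrightarrow> \<not> P_position x)"
  by pat_completeness auto
termination
  by (relation "measure size") (auto dest: size_option_less)

definition game_eq :: "game \<Rightarrow> game \<Rightarrow> bool" (infix "\<doteq>" 50) where
  "G \<doteq> H \<longleftrightarrow> (\<forall>X. P_position (G + X) \<longleftrightarrow> P_position (H + X))"

function formal_birthday :: "game \<Rightarrow> nat" where
  "formal_birthday (Game A) =
     (if A = {||} then 0 else Max ((\<lambda>x. formal_birthday x + 1) ` fset A))"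
  by pat_completeness auto
termination
  by (relation "measure size") (auto dest: size_option_less)

definition birthday :: "game \<Rightarrow> nat" where
  "birthday G = (LEAST n. \<exists>H. H \<doteq> G \<and> formal_birthday H = n)"

definition is_game_unit :: "game \<Rightarrow> bool" where
  "is_game_unit U \<longleftrightarrow> (\<exists>V. U + V \<doteq> 0)"

definition associates :: "game \<Rightarrow> game \<Rightarrow> bool" (infix "\<approx>" 50) where
  "G \<approx> H \<longleftrightarrow> (\<exists>U. is_game_unit U \<and> G \<doteq> H + U)"

definition is_part :: "game \<Rightarrow> game \<Rightarrow> bool" where
  "is_part H G \<longleftrightarrow> (\<exists>X. G \<doteq> H + X)"

definition is_proper_part :: "game \<Rightarrow> game \<Rightarrow> bool" where
  "is_proper_part H G \<longleftrightarrow> is_part H G \<and> \<not> H \<approx> 0 \<and> \<not> H \<approx> G"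

definition prime_game :: "game \<Rightarrow> bool" where
  "prime_game G \<longleftrightarrow> \<not> is_game_unit G \<and> \<not> (\<exists>H. is_proper_part H G)"

text \<open>Since a partition is only considered up to reordering, it is recorded as the multiset of its
  summands. Distinct multisets may still be the same partition up to association, which is the
  relation \<^term>\<open>rel_mset associates\<close>.\<close>

definition prime_partition :: "game \<Rightarrow> game multiset \<Rightarrow> bool" where
  "prime_partition G P \<longleftrightarrow> (\<forall>p \<in># P. prime_game p) \<and> G \<approx> \<Sum>\<^sub># P"

definition UPP :: "game \<Rightarrow> bool" where
  "UPP G \<longleftrightarrow> (\<exists>P. prime_partition G P) \<and>
     (\<forall>P Q. prime_partition G P \<longrightarrow> prime_partition G Q \<longrightarrow> rel_mset associates P Q)"

end

theory Submission
  imports Defs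
begin

text \<open>
  Games are considered modulo association. Every class \<open>c\<close> has a representative of least formal
  birthday; let \<open>opts c\<close> be the classes of its options. By minimality, an option \<open>a' + b\<close> of a sum
  either belongs to \<open>opts (a + b)\<close> or reverts through an equation \<open>a' + b' = a + b\<close>. This gives a strong
  restriction on decompositions: a class with a unit option is prime, and if \<open>x\<close> is an option of \<open>g\<close>,
  then all but one of the primes in any factorization of \<open>g\<close> occur among those of \<open>x\<close>. In particular \<open>g\<close>
  has unique factorization if it has a unit or prime option. All composite classes born by day 5
  turn out to be multiples of \<open>2\<close> with options built only from \<open>2\<close> and \<open>{2}\<close>. Their primes are chained
  by absorption: if a prime \<open>r\<close> has an option \<open>r + y\<close>, then in every factorization of \<open>g\<close> the prime \<open>r\<close>
  comes together with \<open>y\<close>, unless \<open>g + y\<close> is an option of \<open>g\<close>. Hence the parts which factorizations of \<open>g\<close>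
  share with \<open>x\<close> are totally ordered, which forces the factorizations to agree. The argument stops at
  day 7: \<open>{2 + 4}\<close> is divisible by \<open>2\<close> and by \<open>4\<close>, but \<open>2\<close> and \<open>4\<close> are not chained.
\<close>

section \<open>Equality and linked games\<close>

text \<open>A part may be born later than the whole: \<open>sub\<close> is born on day 3, but its
  summand \<open>subq\<close> not before day 5. Induction on birthdays therefore cannot pass from a
  class to its parts, only to its options, and everything about parts has to be read off from the
  options of a sum. An equation \<open>a' + b' = a + b\<close> is informative only because summands
  cancel, which is far from evident for misere equality; cancellation in turn needs to know that the
  only units are \<open>0\<close> and \<open>1\<close>. The numerical leverage is one fact: of
  \<open>q\<close> and \<open>q + 2\<close>, one is an option of the other and born at least two
  days earlier. With day 6 as the limit, this pushes troublesome classes down to days 3 and 4, where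
  they can be described explicitly. One type of option, \<open>2 + {2}\<close>, escapes the chain
  argument; if \<open>g\<close> has no other option, then \<open>2 + {2}\<close> divides
  \<open>g\<close>, which settles uniqueness directly.\<close>

lemma P_position_iff:
  "P_position G \<longleftrightarrow> options G \<noteq> {||} \<and> (\<forall>x. x |\<in>| options G \<longrightarrow> \<not> P_position x)"
  by (cases G) simp

lemma options_plusE:
  assumes "x |\<in>| options (G + H)"
  obtains G' where "G' |\<in>| options G" "x = G' + H"
    | H' where "H' |\<in>| options H" "x = G + H'"
  using assms by (auto simp: options_plus)

lemma options_plusI1: "G' |\<in>| options G \<Longrightarrow> G' + H |\<in>| options (G + H)"
  and options_plusI2: "H' |\<in>| options H \<Longrightarrow> G + H' |\<in>| options (G + H)"
  by (auto simp: options_plus)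

lemma options_plus_empty_iff: "options (G + H) = {||} \<longleftrightarrow> options G = {||} \<and> options H = {||}"
  by (auto simp: options_plus)

lemma options_empty_iff: "options G = {||} \<longleftrightarrow> G = 0"
  by (cases G) (simp add: zero_game_def)

lemma formal_birthday_less:
  assumes "x |\<in>| options G"
  shows "formal_birthday x < formal_birthday G"
proof -
  obtain A where G: "G = Game A" by (cases G)
  have "Suc (formal_birthday x) \<le> (MAX x\<in>fset A. Suc (formal_birthday x))"
    using assms G by (intro Max_ge) auto
  moreover have "formal_birthday G = (MAX x\<in>fset A. Suc (formal_birthday x))"
    using assms G by auto
  ultimately show ?thesis by linarith
qed

lemma formal_birthday_leI:
  assumes "\<And>x. x |\<in>| options G \<Longrightarrow> formal_birthday x < n"
  shows "formal_birthday G \<le> n"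
proof (cases G)
  case (Game A)
  show ?thesis
  proof (cases "A = {||}")
    case False
    then have "fset A \<noteq> {}" by (metis bot_fset.rep_eq fset_cong)
    then show ?thesis using assms Game by (auto simp: Suc_le_eq)
  qed (simp add: Game)
qed

lemma game_eq_refl [simp]: "G \<doteq> G"
  and game_eq_sym: "G \<doteq> H \<Longrightarrow> H \<doteq> G"
  and game_eq_trans [trans]: "G \<doteq> H \<Longrightarrow> H \<doteq> K \<Longrightarrow> G \<doteq> K"
  by (auto simp: game_eq_def)

lemma game_eq_plus_right: "G \<doteq> H \<Longrightarrow> G + X \<doteq> H + X"
  by (auto simp: game_eq_def add.assoc)

lemma game_eq_plus: "G \<doteq> H \<Longrightarrow> X \<doteq> Y \<Longrightarrow> G + X \<doteq> H + Y"
  by (metis game_eq_plus_right game_eq_trans add.commute)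

lemma game_eq_P_position: "G \<doteq> H \<Longrightarrow> P_position G \<longleftrightarrow> P_position H"
  unfolding game_eq_def by (metis add.right_neutral)

text \<open>In misere play \<open>0\<close> needs the mate \<open>1\<close>, because the player to
  move wins at \<open>0\<close>. Otherwise mates are formed option by option, so that each move in
  one summand of \<open>G + mate G\<close> has an answer in the other.\<close>

function mate :: "game \<Rightarrow> game" where
  "mate (Game A) = (if A = {||} then Game {|0|} else Game (mate |`| A))"
  by pat_completeness auto
termination
  by (relation "measure size") (auto dest: size_option_less)

lemma P_position_plus_mate: "P_position (G + mate G)"
proof (induction "size G" arbitrary: G rule: less_induct)
  case less
  have IH: "P_position (x + mate x)" if "x |\<in>| options G" for x
    using less size_options_less that by blast
  show ?case
  proof (cases "G = 0")
    case True
    then show ?thesis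
      by (auto simp: zero_game_def P_position_iff[of "_ + _"] options_plus)
  next
    case False
    then have ne: "options G \<noteq> {||}" by (simp add: options_empty_iff)
    have m: "options (mate G) = mate |`| options G"
      using ne by (cases G) auto
    have "\<not> P_position x" if x: "x |\<in>| options (G + mate G)" for x
    proof -
      have "\<exists>y. y |\<in>| options x \<and> P_position y"
        using x IH m by (fastforce elim!: options_plusE intro: options_plusI1 options_plusI2)
      then show ?thesis by (auto simp: P_position_iff[of x])
    qed
    then show ?thesis
      using ne by (auto simp: P_position_iff[of "_ + _"] options_plus_empty_iff)
  qed
qed

text \<open>Outcomes of unequal games can be separated in either prescribed direction: the options
  \<open>mate x\<close> take away every other winning move of the second player.\<close>

lemma not_game_eqE:
  assumes "\<not> G \<doteq> H"
  obtains T where "P_position (G + T)" "\<not> P_position (H + T)"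
proof (cases "\<exists>T. P_position (G + T) \<and> \<not> P_position (H + T)")
  case False
  with assms obtain T where T: "\<not> P_position (G + T)" "P_position (H + T)"
    unfolding game_eq_def by blast
  define S where "S = Game (finsert T (mate |`| options G))"
  have S: "options S = finsert T (mate |`| options G)" by (simp add: S_def)
  have "\<not> P_position x" if x: "x |\<in>| options (G + S)" for x
    using x
  proof (cases rule: options_plusE)
    case (1 G')
    then have "G' + mate G' |\<in>| options x" by (auto simp: S intro: options_plusI2)
    then show ?thesis using P_position_plus_mate P_position_iff[of x] by blast
  next
    case (2 S')
    show ?thesis
    proof (cases "S' = T")
      case False
      then obtain G' where "G' |\<in>| options G" "S' = mate G'" using 2 S by auto
      then have "G' + mate G' |\<in>| options x" using 2 by (auto intro: options_plusI1)
      then show ?thesis using P_position_plus_mate P_position_iff[of x] by blast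
    qed (use 2 T in simp)
  qed
  then have "P_position (G + S)"
    by (auto simp: P_position_iff[of "_ + _"] options_plus_empty_iff S)
  moreover have "\<not> P_position (H + S)"
    using T(2) by (auto simp: P_position_iff[of "H + S"] S intro!: exI[of _ "H + T"] options_plusI2)
  ultimately show ?thesis using that by blast
qed (use that in blast)

text \<open>Linked games turn out to be exactly those of which neither equals an option of the
  other. This converts a condition on contexts into one on options.\<close>

definition linked :: "game \<Rightarrow> game \<Rightarrow> bool" where
  "linked G H \<longleftrightarrow> (\<exists>T. P_position (G + T) \<and> P_position (H + T))"

lemma linked_sym: "linked G H \<Longrightarrow> linked H G"
  by (auto simp: linked_def)

lemma not_linked_option:
  assumes "H' |\<in>| options H" "G \<doteq> H'"
  shows "\<not> linked G H"
proof
  assume "linked G H"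
  then obtain T where T: "P_position (G + T)" "P_position (H + T)" by (auto simp: linked_def)
  have "P_position (H' + T)" using T(1) assms(2) by (simp add: game_eq_def)
  then show False
    using T(2) options_plusI1[OF assms(1)] by (auto simp: P_position_iff[of "H + T"])
qed

text \<open>The context \<open>T\<close> is assembled from separators: for each \<open>H'\<close> a
  game that makes \<open>H'\<close> a P-position but not \<open>G\<close>, and for each
  \<open>G'\<close> one that does the same for \<open>G'\<close> and \<open>H\<close>. Every move
  from \<open>G + T\<close> or \<open>H + T\<close> is then an N-position by choice of the
  separator, or can be answered by pairing an option with its own separator.\<close>

lemma linkedI:
  assumes "\<And>H'. H' |\<in>| options H \<Longrightarrow> \<not> G \<doteq> H'" "\<And>G'. G' |\<in>| options G \<Longrightarrow> \<not> G' \<doteq> H"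
  shows "linked G H"
proof (cases "options G = {||} \<and> options H = {||}")
  case True
  then have "G = H" by (simp add: options_empty_iff)
  then show ?thesis using P_position_plus_mate by (auto simp: linked_def)
next
  case False
  have "\<exists>X. P_position (H' + X) \<and> \<not> P_position (G + X)" if "H' |\<in>| options H" for H'
    using assms(1)[OF that] not_game_eqE[of H' G] game_eq_sym by metis
  then obtain X where X: "\<And>H'. H' |\<in>| options H \<Longrightarrow> P_position (H' + X H') \<and> \<not> P_position (G + X H')"
    by metis
  have "\<exists>Y. P_position (G' + Y) \<and> \<not> P_position (H + Y)" if "G' |\<in>| options G" for G'
    using assms(2)[OF that] not_game_eqE[of G' H] by metis
  then obtain Y where Y: "\<And>G'. G' |\<in>| options G \<Longrightarrow> P_position (G' + Y G') \<and> \<not> P_position (H + Y G')"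
    by metis
  define T where "T = Game (X |`| options H |\<union>| Y |`| options G)"
  have T: "options T = X |`| options H |\<union>| Y |`| options G" by (simp add: T_def)
  have *: "\<not> P_position x" if "y |\<in>| options x" "P_position y" for x y
    using that by (auto simp: P_position_iff[of x])
  have "\<not> P_position x" if x: "x |\<in>| options (G + T)" for x
    using x
  proof (cases rule: options_plusE)
    case (1 G')
    then show ?thesis using Y by (intro *[of "G' + Y G'"]) (auto simp: T intro: options_plusI2)
  next
    case (2 T')
    then consider (a) H' where "H' |\<in>| options H" "T' = X H'" | (b) G' where "G' |\<in>| options G" "T' = Y G'"
      by (auto simp: T)
    then show ?thesis
    proof cases
      case b
      then show ?thesis using Y 2 by (intro *[of "G' + Y G'"]) (auto intro: options_plusI1)
    qed (use X 2 in auto)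
  qed
  moreover have "\<not> P_position x" if x: "x |\<in>| options (H + T)" for x
    using x
  proof (cases rule: options_plusE)
    case (1 H')
    then show ?thesis using X by (intro *[of "H' + X H'"]) (auto simp: T intro: options_plusI2)
  next
    case (2 T')
    then consider (a) H' where "H' |\<in>| options H" "T' = X H'" | (b) G' where "G' |\<in>| options G" "T' = Y G'"
      by (auto simp: T)
    then show ?thesis
    proof cases
      case a
      then show ?thesis using X 2 by (intro *[of "H' + X H'"]) (auto intro: options_plusI1)
    qed (use Y 2 in auto)
  qed
  moreover have "options T \<noteq> {||}" using False by (auto simp: T)
  ultimately have "P_position (G + T)" "P_position (H + T)"
    by (auto simp: P_position_iff[of "_ + _"] options_plus_empty_iff)
  then show ?thesis by (auto simp: linked_def)
qed

text \<open>If \<open>G'\<close> neither matched an option of \<open>H\<close> nor reverted to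
  \<open>H\<close>, it would be linked to \<open>H\<close>. As \<open>G\<close> equals
  \<open>H\<close>, some context would then make both \<open>G\<close> and its option
  \<open>G'\<close> P-positions.\<close>

lemma game_eq_option:
  assumes "G \<doteq> H" "G' |\<in>| options G"
  shows "(\<exists>H'. H' |\<in>| options H \<and> G' \<doteq> H') \<or> (\<exists>G''. G'' |\<in>| options G' \<and> G'' \<doteq> H)"
proof (rule ccontr)
  assume "\<not> ?thesis"
  then have "linked G' H" by (intro linkedI) auto
  then obtain T where T: "P_position (G' + T)" "P_position (H + T)" by (auto simp: linked_def)
  then have "P_position (G + T)" using assms(1) by (simp add: game_eq_def)
  then show False
    using T(1) options_plusI1[OF assms(2)] by (auto simp: P_position_iff[of "G + T"])
qed

text \<open>The outcome hypotheses matter only when one side has no options; \<open>{2}\<close> versus \<open>0\<close> shows that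
  they cannot be dropped.\<close>

lemma game_eqI:
  assumes 1: "\<And>G'. G' |\<in>| options G \<Longrightarrow>
      (\<exists>H'. H' |\<in>| options H \<and> G' \<doteq> H') \<or> (\<exists>G''. G'' |\<in>| options G' \<and> G'' \<doteq> H)"
    and 2: "\<And>H'. H' |\<in>| options H \<Longrightarrow>
      (\<exists>G'. G' |\<in>| options G \<and> H' \<doteq> G') \<or> (\<exists>H''. H'' |\<in>| options H' \<and> H'' \<doteq> G)"
    and 3: "G = 0 \<Longrightarrow> \<not> P_position H" "H = 0 \<Longrightarrow> \<not> P_position G"
  shows "G \<doteq> H"
proof -
  have aux: False
    if G: "\<And>H'. H' |\<in>| options H \<Longrightarrow> \<not> linked H' G" "H = 0 \<Longrightarrow> \<not> P_position G"
      and X: "\<And>X'. X' |\<in>| options X \<Longrightarrow> P_position (G + X') \<longleftrightarrow> P_position (H + X')"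
      and P: "P_position (G + X)" "\<not> P_position (H + X)" for G H X
  proof (cases "options (H + X) = {||}")
    case True
    then have "H = 0" "X = 0"
      unfolding options_plus_empty_iff by (simp_all add: options_empty_iff)
    then show False using G(2) P(1) by simp
  next
    case False
    then obtain y where y: "y |\<in>| options (H + X)" "P_position y"
      using P(2) by (auto simp: P_position_iff[of "H + X"])
    from y(1) show False
    proof (cases rule: options_plusE)
      case (1 H')
      then show ?thesis using G(1)[of H'] y(2) P(1) by (auto simp: linked_def)
    next
      case (2 X')
      then have "P_position (G + X')" using X y(2) by simp
      then show ?thesis using P(1) options_plusI2[OF 2(1)] by (auto simp: P_position_iff[of "G + X"])
    qed
  qed
  have "\<not> linked G' H" if "G' |\<in>| options G" for G'
    using 1[OF that] not_linked_option linked_sym game_eq_sym by meson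
  moreover have "\<not> linked H' G" if "H' |\<in>| options H" for H'
    using 2[OF that] not_linked_option linked_sym game_eq_sym by meson
  ultimately have "P_position (G + X) \<longleftrightarrow> P_position (H + X)" for X
  proof (induction "size X" arbitrary: X rule: less_induct)
    case less
    then have "P_position (G + X') \<longleftrightarrow> P_position (H + X')" if "X' |\<in>| options X" for X'
      using that size_options_less by blast
    then show ?case using aux[of H G X] aux[of G H X] less.prems 3 by metis
  qed
  then show ?thesis by (simp add: game_eq_def)
qed

section \<open>Canonical games and units\<close>

lemma game_eq_if_same_opts:
  assumes "\<And>G'. G' |\<in>| options G \<Longrightarrow> \<exists>H'. H' |\<in>| options H \<and> G' \<doteq> H'"
    and "\<And>H'. H' |\<in>| options H \<Longrightarrow> \<exists>G'. G' |\<in>| options G \<and> G' \<doteq> H'"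
  shows "G \<doteq> H"
proof (rule game_eqI)
  have "G = 0 \<longleftrightarrow> H = 0"
    using assms by (auto simp flip: options_empty_iff)
  then show "G = 0 \<Longrightarrow> \<not> P_position H" "H = 0 \<Longrightarrow> \<not> P_position G"
    by (simp_all add: P_position_iff[of 0])
qed (use assms game_eq_sym in blast)+

text \<open>Hereditary minimality of the birthday stands in for the absence of reversible options:
  irreversibility follows from it, and the proviso on deleting all options does not arise.\<close>

inductive canonical :: "game \<Rightarrow> bool" where
  "(\<And>H. H \<doteq> G \<Longrightarrow> formal_birthday G \<le> formal_birthday H) \<Longrightarrow>
   (\<And>G'. G' |\<in>| options G \<Longrightarrow> canonical G') \<Longrightarrow> canonical G"

lemma canonical_option: "canonical G \<Longrightarrow> G' |\<in>| options G \<Longrightarrow> canonical G'"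
  by (auto elim: canonical.cases)

lemma canonical_minimal: "canonical G \<Longrightarrow> H \<doteq> G \<Longrightarrow> formal_birthday G \<le> formal_birthday H"
  by (auto elim: canonical.cases)

lemma canonical_irreversible:
  assumes "canonical G" "G' |\<in>| options G" "G'' |\<in>| options G'"
  shows "\<not> G'' \<doteq> G"
  using formal_birthday_less[OF assms(2)] formal_birthday_less[OF assms(3)]
    canonical_minimal[OF assms(1), of G''] by auto

lemma canonical_option_neq:
  assumes "canonical G" "G' |\<in>| options G"
  shows "\<not> G' \<doteq> G"
  using formal_birthday_less[OF assms(2)] canonical_minimal[OF assms(1), of G'] by auto

lemma game_eq_canonicalE:
  obtains K where "canonical K" "K \<doteq> G" "formal_birthday K \<le> formal_birthday G"
proof -
  have "\<exists>K. canonical K \<and> K \<doteq> G \<and> formal_birthday K \<le> formal_birthday G"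
  proof (induction "formal_birthday G" arbitrary: G rule: less_induct)
    case less
    obtain H where H: "H \<doteq> G" "\<And>K. K \<doteq> G \<Longrightarrow> formal_birthday H \<le> formal_birthday K"
      using ex_has_least_nat[of "\<lambda>H. H \<doteq> G" G formal_birthday] by auto
    have "\<exists>K. canonical K \<and> K \<doteq> x \<and> formal_birthday K \<le> formal_birthday x"
      if "x |\<in>| options H" for x
      using less[of x] formal_birthday_less[OF that] H(2)[of G] by simp
    then obtain k where k: "\<And>x. x |\<in>| options H \<Longrightarrow>
        canonical (k x) \<and> k x \<doteq> x \<and> formal_birthday (k x) \<le> formal_birthday x"
      by metis
    define K where "K = Game (k |`| options H)"
    have "K \<doteq> H"
      by (rule game_eq_if_same_opts) (use k in \<open>auto simp: K_def\<close>)
    moreover have "formal_birthday K \<le> formal_birthday H"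
      by (rule formal_birthday_leI) (use k formal_birthday_less in \<open>fastforce simp: K_def\<close>)
    moreover have "canonical K"
    proof
      show "formal_birthday K \<le> formal_birthday J" if "J \<doteq> K" for J
        using that \<open>K \<doteq> H\<close> H \<open>formal_birthday K \<le> formal_birthday H\<close> game_eq_trans le_trans by meson
    qed (use k in \<open>auto simp: K_def\<close>)
    ultimately show ?case
      using H game_eq_trans le_trans game_eq_refl by meson
  qed
  then show ?thesis using that by blast
qed

section \<open>The heaps \<open>0\<close>, \<open>1\<close>, \<open>2\<close> and the classification
  of units\<close>

definition nim1 :: game where "nim1 = Game {|0|}"
definition nim2 :: game where "nim2 = Game {|0, nim1|}"

lemma options_nim [simp]: "options nim1 = {|0|}" "options nim2 = {|0, nim1|}"
  by (simp_all add: nim1_def nim2_def)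

lemma P_position_nim [simp]: "\<not> P_position 0" "P_position nim1" "\<not> P_position nim2"
  by (simp_all add: zero_game_def nim1_def nim2_def)

lemma Game_nim1_eq_0: "Game {|nim1|} \<doteq> 0"
  by (rule game_eqI) auto

lemma nim1_plus_nim1: "nim1 + nim1 \<doteq> 0"
proof (rule game_eqI)
  show "\<not> P_position (nim1 + nim1)"
    by (subst P_position_iff) (simp add: options_plus)
qed (auto simp: options_plus)

lemma nim2_neq_0: "\<not> nim2 \<doteq> 0"
  using game_eq_option[of nim2 0 0] by auto

lemma nim2_plus_nim2_neq_0: "\<not> nim2 + nim2 \<doteq> 0"
proof
  assume "nim2 + nim2 \<doteq> 0"
  then have "P_position (nim2 + nim2) = P_position 0" by (rule game_eq_P_position)
  moreover have "\<not> P_position (nim1 + nim2)"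
    using options_plusI2[of nim1 nim2 nim1] options_plusI2[of 0 nim2 nim1]
    by (subst P_position_iff) (metis P_position_nim(2) add.right_neutral finsertI1 options_nim(2))
  ultimately show False
    by (simp add: options_plus P_position_iff[of "nim2 + nim2"] add.commute[of nim2 nim1])
qed

lemma unit_cancel:
  assumes "V + U \<doteq> 0" "X + V \<doteq> Y + V"
  shows "X \<doteq> Y"
proof -
  have "X \<doteq> X + (V + U)"
    using game_eq_plus[OF game_eq_refl game_eq_sym[OF assms(1)], of X] by simp
  also have "X + (V + U) \<doteq> Y + (V + U)"
    using game_eq_plus_right[OF assms(2), of U] by (simp add: add.assoc)
  also have "Y + (V + U) \<doteq> Y"
    using game_eq_plus[OF game_eq_refl assms(1), of Y] by simp
  finally show ?thesis .
qed

text \<open>The only option set that is not already that of a heap is \<open>{1}\<close>. It reverts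
  to \<open>0\<close>, and may do so because \<open>{1}\<close>, like \<open>0\<close>, is an
  N-position.\<close>

lemma unit_options_cases:
  assumes "\<And>x. x |\<in>| options G \<Longrightarrow> x \<doteq> 0 \<or> x \<doteq> nim1"
  shows "G \<doteq> 0 \<or> G \<doteq> nim1 \<or> G \<doteq> nim2"
proof (cases "\<exists>x y. x |\<in>| options G \<and> y |\<in>| options G \<and> x \<doteq> 0 \<and> y \<doteq> nim1")
  case True
  then have "G \<doteq> nim2"
    by (intro game_eq_if_same_opts) (use assms in \<open>fastforce+\<close>)
  then show ?thesis by blast
next
  case no: False
  consider (none) "options G = {||}"
    | (zero) x where "x |\<in>| options G" "x \<doteq> 0"
    | (one) x where "x |\<in>| options G" "x \<doteq> nim1"
    using assms by (metis all_not_fin_conv)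
  then show ?thesis
  proof cases
    case none
    then show ?thesis by (simp add: options_empty_iff)
  next
    case zero
    have "G \<doteq> nim1"
      by (rule game_eq_if_same_opts) (use zero no assms in auto)
    then show ?thesis by blast
  next
    case one
    have "G \<doteq> Game {|nim1|}"
      by (rule game_eq_if_same_opts) (use one no assms in auto)
    then show ?thesis using Game_nim1_eq_0 game_eq_trans by blast
  qed
qed

text \<open>In a pair with \<open>U + V = 0\<close>, every option of one game has an inverse among
  the options of the other: \<open>0\<close> has no options, so \<open>U' + V\<close> reverts to
  \<open>0\<close>, and reverting to \<open>U'' + V\<close> would give \<open>U'' = U\<close>. By
  induction all these options are \<open>0\<close> or \<open>1\<close>, so both games are among
  \<open>0\<close>, \<open>1\<close>, \<open>2\<close>; and \<open>2 + 2\<close> is not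
  \<open>0\<close>.\<close>

lemma unit_cases:
  assumes "U + V \<doteq> 0"
  shows "U \<doteq> 0 \<or> U \<doteq> nim1"
proof -
  have unit_opts: "\<exists>V'. V' |\<in>| options V \<and> U' + V' \<doteq> 0"
    if U: "canonical U" "U + V \<doteq> 0" "U' |\<in>| options U" for U V U'
  proof -
    obtain w where w: "w |\<in>| options (U' + V)" "w \<doteq> 0"
      using game_eq_option[OF U(2) options_plusI1[OF U(3)]] by auto
    from w(1) show ?thesis
    proof (cases rule: options_plusE)
      case (1 U'')
      have "V + U \<doteq> 0" using U(2) by (simp add: add.commute)
      moreover have "U'' + V \<doteq> U + V" using w 1 U(2) game_eq_sym game_eq_trans by blast
      ultimately have "U'' \<doteq> U" by (rule unit_cancel)
      then show ?thesis using canonical_irreversible[OF U(1,3) 1(1)] by simp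
    qed (use w in auto)
  qed
  have *: "U \<doteq> 0 \<or> U \<doteq> nim1" if "canonical U" "canonical V" "U + V \<doteq> 0" for U V
    using that
  proof (induction "formal_birthday U + formal_birthday V" arbitrary: U V rule: less_induct)
    case less
    have VU: "V + U \<doteq> 0" using less.prems(3) by (simp add: add.commute)
    have "U' \<doteq> 0 \<or> U' \<doteq> nim1" if x: "U' |\<in>| options U" for U'
    proof -
      obtain V' where V': "V' |\<in>| options V" "U' + V' \<doteq> 0"
        using unit_opts[OF less.prems(1,3) x] by blast
      show ?thesis
        by (rule less.hyps[of U' V'])
          (use V' x less.prems(1,2) canonical_option formal_birthday_less[OF x] formal_birthday_less[OF V'(1)] in auto)
    qed
    then have U: "U \<doteq> 0 \<or> U \<doteq> nim1 \<or> U \<doteq> nim2" by (rule unit_options_cases)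
    have "V' \<doteq> 0 \<or> V' \<doteq> nim1" if x: "V' |\<in>| options V" for V'
    proof -
      obtain U' where U': "U' |\<in>| options U" "V' + U' \<doteq> 0"
        using unit_opts[OF less.prems(2) VU x] by blast
      show ?thesis
        by (rule less.hyps[of V' U'])
          (use U' x less.prems(1,2) canonical_option formal_birthday_less[OF x] formal_birthday_less[OF U'(1)] in auto)
    qed
    then have "V \<doteq> 0 \<or> V \<doteq> nim1 \<or> V \<doteq> nim2" by (rule unit_options_cases)
    then consider (unit) u where "u \<in> {0, nim1}" "V \<doteq> u" | (nim2) "V \<doteq> nim2" by blast
    then show ?case
    proof cases
      case unit
      then have uu: "u + u \<doteq> 0" using nim1_plus_nim1 by auto
      have "U + u \<doteq> U + V" using game_eq_plus[OF game_eq_refl game_eq_sym[OF unit(2)]] .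
      also have "U + V \<doteq> 0" by (rule less.prems)
      also have "0 \<doteq> u + u" using uu by (rule game_eq_sym)
      finally have "U \<doteq> u" by (rule unit_cancel[OF uu])
      then show ?thesis using unit by auto
    next
      case nim2
      have "\<not> U \<doteq> nim2"
      proof
        assume "U \<doteq> nim2"
        then have "U + V \<doteq> nim2 + nim2" using nim2 by (rule game_eq_plus)
        then show False
          using game_eq_trans[OF game_eq_sym less.prems(3)] nim2_plus_nim2_neq_0 by blast
      qed
      then show ?thesis using U by blast
    qed
  qed
  obtain K where K: "canonical K" "K \<doteq> U" using game_eq_canonicalE by metis
  obtain L where L: "canonical L" "L \<doteq> V" using game_eq_canonicalE by metis
  have "K + L \<doteq> 0" using game_eq_plus[OF K(2) L(2)] assms game_eq_trans by blast
  then have "K \<doteq> 0 \<or> K \<doteq> nim1" using * K L by blast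
  then show ?thesis using K(2) game_eq_sym game_eq_trans by blast
qed

text \<open>\<open>K\<close> is an option of \<open>K + 1\<close>, so equality with \<open>K\<close>
  would produce an option of \<open>K\<close> equal to \<open>K\<close>.\<close>

lemma plus_nim1_neq: "\<not> X + nim1 \<doteq> X"
proof
  assume X: "X + nim1 \<doteq> X"
  obtain K where K: "canonical K" "K \<doteq> X" using game_eq_canonicalE by metis
  have "K + nim1 \<doteq> K"
    by (rule game_eq_trans[OF game_eq_trans[OF game_eq_plus_right[OF K(2)] X] game_eq_sym[OF K(2)]])
  moreover have "K |\<in>| options (K + nim1)" using options_plusI2[of 0 nim1 K] by simp
  ultimately have "(\<exists>K'. K' |\<in>| options K \<and> K \<doteq> K') \<or> (\<exists>K'. K' |\<in>| options K \<and> K' \<doteq> K)"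
    by (rule game_eq_option)
  then show False using canonical_option_neq[OF K(1)] game_eq_sym by blast
qed

text \<open>With \<open>K\<close> canonical, each option of \<open>K\<close> must equal an option of
  \<open>K + H\<close>. If some \<open>K'\<close> equals \<open>K + H'\<close>, then
  \<open>K'\<close> absorbs \<open>H\<close> as well and induction applies. Otherwise
  \<open>H\<close> splits off from options of \<open>K\<close> again and again, and finiteness
  yields a cycle.\<close>

lemma plus_eq_selfD: "X + H \<doteq> X \<Longrightarrow> H \<doteq> 0"
proof (induction "formal_birthday X" arbitrary: X H rule: less_induct)
  case less
  obtain K where K: "canonical K" "K \<doteq> X" "formal_birthday K \<le> formal_birthday X"
    using game_eq_canonicalE by metis
  have KH: "K + H \<doteq> K"
    by (rule game_eq_trans[OF game_eq_trans[OF game_eq_plus_right[OF K(2)] less.prems]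
          game_eq_sym[OF K(2)]])
  have IH: "Y \<doteq> 0" if "K' |\<in>| options K" "K' + Y \<doteq> K'" for K' Y
    using less.hyps[OF _ that(2)] formal_birthday_less[OF that(1)] K(3) by simp
  have step: "\<exists>y. y |\<in>| options (K + H) \<and> K' \<doteq> y" if "K' |\<in>| options K" for K'
    using game_eq_option[OF game_eq_sym[OF KH] that] canonical_irreversible[OF K(1) that]
      game_eq_trans[OF _ KH] by meson
  show ?case
  proof (cases "\<exists>K' H'. K' |\<in>| options K \<and> H' |\<in>| options H \<and> K' \<doteq> K + H'")
    case True
    then obtain K' H' where *: "K' |\<in>| options K" "K' \<doteq> K + H'" by blast
    have "K' + H \<doteq> K + H' + H" using *(2) by (rule game_eq_plus_right)
    also have "K + H' + H = K + H + H'" by (simp add: add_ac)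
    also have "K + H + H' \<doteq> K + H'" using KH by (rule game_eq_plus_right)
    also have "K + H' \<doteq> K'" using * game_eq_sym by blast
    finally show ?thesis using IH * by blast
  next
    case False
    then have "\<exists>K''. K'' |\<in>| options K \<and> K' \<doteq> K'' + H" if "K' |\<in>| options K" for K'
      using step[OF that] that by (auto simp: options_plus)
    then obtain f where f: "\<And>K'. K' |\<in>| options K \<Longrightarrow> f K' |\<in>| options K \<and> K' \<doteq> f K' + H"
      by metis
    show ?thesis
    proof (cases "options K = {||}")
      case True
      then have "K = 0" by (simp add: options_empty_iff)
      then show ?thesis using KH by simp
    next
      case False
      then obtain k0 where k0: "k0 |\<in>| options K" by blast
      define a where "a n = (f ^^ n) k0" for n
      define N where "N n = ((\<lambda>Y. Y + H) ^^ n) 0" for n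
      have a: "a n |\<in>| options K" for n
        by (induction n) (auto simp: a_def k0 f)
      have aN: "a i \<doteq> a (i + n) + N n" for i n
      proof (induction n)
        case (Suc n)
        have "a (i + n) + N n \<doteq> (a (i + Suc n) + H) + N n"
          using f[OF a[of "i + n"]] by (intro game_eq_plus_right) (simp add: a_def)
        with Suc have "a i \<doteq> (a (i + Suc n) + H) + N n" by (rule game_eq_trans)
        then show ?case by (simp add: N_def add_ac)
      qed (simp add: N_def)
      have "\<not> inj a"
      proof
        assume "inj a"
        moreover have "finite (range a)"
          by (rule finite_subset[of _ "fset (options K)"]) (use a in auto)
        ultimately show False using finite_imageD by blast
      qed
      then obtain i j where ij: "i < j" "a i = a j"
        by (metis injI linorder_neqE_nat)
      have "a i \<doteq> a i + N (j - i)" using aN[of i "j - i"] ij by simp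
      then have "N (j - i) \<doteq> 0" using IH a game_eq_sym by blast
      moreover obtain m where "j - i = Suc m" using ij by (metis Suc_diff_Suc)
      ultimately have "H + N m \<doteq> 0" by (simp add: N_def add.commute)
      then have "H \<doteq> 0 \<or> H \<doteq> nim1" by (rule unit_cases)
      moreover have "\<not> H \<doteq> nim1"
      proof
        assume "H \<doteq> nim1"
        then have "K + nim1 \<doteq> K + H" by (intro game_eq_plus) (auto intro: game_eq_sym)
        then show False using game_eq_trans[OF _ KH] plus_nim1_neq by metis
      qed
      ultimately show ?thesis by blast
    qed
  qed
qed

section \<open>Cancellation\<close>

text \<open>If \<open>A\<close> and \<open>B\<close> are linked, then by cancellation in smaller positions any
  coincidence \<open>A + Y = B + Y'\<close> or \<open>A + Y' = B + Y\<close> forces another one below \<open>Y\<close>.\<close>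

lemma linked_descent:
  assumes a: "\<And>A' Z. A' |\<in>| options A \<Longrightarrow> formal_birthday Z < n \<Longrightarrow> \<not> A' + Z \<doteq> B + Z"
    and b: "\<And>B' Z. B' |\<in>| options B \<Longrightarrow> formal_birthday Z < n \<Longrightarrow> \<not> A + Z \<doteq> B' + Z"
    and c: "\<And>Y Z. formal_birthday Y \<le> n \<Longrightarrow> formal_birthday Z \<le> n \<Longrightarrow> A + Y \<doteq> A + Z \<Longrightarrow> Y \<doteq> Z"
    and "canonical Y" "formal_birthday Y \<le> n" "Y' |\<in>| options Y"
  shows "\<not> A + Y \<doteq> B + Y'" "\<not> A + Y' \<doteq> B + Y"
proof -
  have "\<not> A + Y \<doteq> B + Y' \<and> \<not> A + Y' \<doteq> B + Y"
    using assms(4-)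
  proof (induction "formal_birthday Y" arbitrary: Y Y' rule: less_induct)
    case less
    have Y': "canonical Y'" "formal_birthday Y' < formal_birthday Y" "formal_birthday Y' < n"
      using less.prems canonical_option formal_birthday_less[OF less.prems(3)] by auto
    have IH: "\<not> A + Y' \<doteq> B + Y''" "\<not> A + Y'' \<doteq> B + Y'" if "Y'' |\<in>| options Y'" for Y''
      using less.hyps[of Y' Y''] that Y' by auto
    have "False" if eq: "A + Y \<doteq> B + Y'"
      using game_eq_option[OF eq options_plusI2[OF less.prems(3)]]
    proof (elim disjE exE conjE)
      fix w assume w: "w |\<in>| options (B + Y')" "A + Y' \<doteq> w"
      from w(1) show False
        by (cases rule: options_plusE) (use w(2) b IH Y' in auto)
    next
      fix w assume w: "w |\<in>| options (A + Y')" "w \<doteq> B + Y'"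
      from w(1) show False
      proof (cases rule: options_plusE)
        case (2 Y'')
        then have "A + Y'' \<doteq> A + Y" using game_eq_trans[OF w(2) game_eq_sym[OF eq]] by simp
        moreover have "formal_birthday Y'' \<le> n" using 2 formal_birthday_less[of Y'' Y'] Y' by simp
        ultimately show ?thesis
          using c[of Y'' Y] canonical_irreversible[OF less.prems(1,3) 2(1)] less.prems by blast
      qed (use w(2) a Y' in auto)
    qed
    moreover have "False" if eq: "A + Y' \<doteq> B + Y"
      using game_eq_option[OF game_eq_sym[OF eq] options_plusI2[OF less.prems(3)]]
    proof (elim disjE exE conjE)
      fix w assume w: "w |\<in>| options (A + Y')" "B + Y' \<doteq> w"
      from w(1) show False
        by (cases rule: options_plusE) (use game_eq_sym[OF w(2)] a IH Y' in auto)
    next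
      fix w assume w: "w |\<in>| options (B + Y')" "w \<doteq> A + Y'"
      from w(1) show False
        by (cases rule: options_plusE) (use game_eq_sym[OF w(2)] b IH Y' in auto)
    qed
    ultimately show ?case by blast
  qed
  then show "\<not> A + Y \<doteq> B + Y'" "\<not> A + Y' \<doteq> B + Y" by auto
qed

text \<open>The first measure is built so that compared games and context can exchange roles, as
  when \<open>P'\<close> is cancelled from \<open>P' + Y = P' + Z\<close>. The second decreases when
  an option replaces the earlier born of the compared games and the maximum stays the same.\<close>

theorem game_plus_cancel:
  assumes "G + X \<doteq> H + X"
  shows "G \<doteq> H"
  using assms
proof (induction "(G, H, X)" arbitrary: G H X rule: wf_induct_rule[OF wf_measures[of
        "[\<lambda>(G, H, X). max (formal_birthday G) (formal_birthday H) + formal_birthday X,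
          \<lambda>(G, H, X). formal_birthday G + formal_birthday H]"]])
  case (1 G H X)
  note IH = "1.hyps"
  note eq = "1.prems"
  let ?b = formal_birthday
  obtain K where K: "canonical K" "K \<doteq> X" "?b K \<le> ?b X"
    using game_eq_canonicalE by metis
  have GK: "G + K \<doteq> H + K"
    using game_eq_trans[OF game_eq_trans[OF game_eq_plus[OF game_eq_refl K(2)] eq]
        game_eq_plus[OF game_eq_refl game_eq_sym[OF K(2)]]] .
  \<comment> \<open>An option \<open>P'\<close> without counterpart would be linked to
    \<open>Q\<close>, while \<open>P + K = Q + K\<close> demands a coincidence that is excluded by
    induction or by the descent.\<close>
  have half: "(\<exists>Q'. Q' |\<in>| options Q \<and> P' \<doteq> Q') \<or> (\<exists>P''. P'' |\<in>| options P' \<and> P'' \<doteq> Q)"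
    if PQ: "P = G \<and> Q = H \<or> P = H \<and> Q = G" and P': "P' |\<in>| options P" for P P' Q
  proof (rule ccontr)
    assume "\<not> ?thesis"
    then have n: "\<And>Q'. Q' |\<in>| options Q \<Longrightarrow> \<not> P' \<doteq> Q'" "\<And>P''. P'' |\<in>| options P' \<Longrightarrow> \<not> P'' \<doteq> Q"
      by auto
    have m: "max (?b G) (?b H) = max (?b P) (?b Q)" "?b G + ?b H = ?b P + ?b Q"
      using PQ by auto
    have bP': "?b P' < ?b P" using P' by (rule formal_birthday_less)
    have a: "\<not> A' + Z \<doteq> Q + Z" if "A' |\<in>| options P'" "?b Z \<le> ?b K" for A' Z
    proof
      assume "A' + Z \<doteq> Q + Z"
      then have "A' \<doteq> Q"
        by (intro IH[of A' Q Z]) (use formal_birthday_less[OF that(1)] that(2) bP' m K(3) in auto)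
      then show False using n that by blast
    qed
    have b: "\<not> P' + Z \<doteq> Q' + Z" if "Q' |\<in>| options Q" "?b Z \<le> ?b K" for Q' Z
    proof
      assume "P' + Z \<doteq> Q' + Z"
      then have "P' \<doteq> Q'"
        by (intro IH[of P' Q' Z]) (use formal_birthday_less[OF that(1)] that(2) bP' m K(3) in auto)
      then show False using n that by blast
    qed
    have c: "Y \<doteq> Z" if "?b Y \<le> ?b K" "?b Z \<le> ?b K" "P' + Y \<doteq> P' + Z" for Y Z
      by (rule IH[of Y Z P']) (use that bP' m K(3) in \<open>auto simp: add.commute\<close>)
    note descent = linked_descent[OF a[OF _ less_imp_le] b[OF _ less_imp_le] c K(1) order.refl]
    have "P + K \<doteq> Q + K" using PQ GK game_eq_sym by blast
    from game_eq_option[OF this options_plusI1[OF P']] show False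
    proof (elim disjE exE conjE)
      fix w assume w: "w |\<in>| options (Q + K)" "P' + K \<doteq> w"
      from w(1) show False
        by (cases rule: options_plusE) (use w(2) b descent in auto)
    next
      fix w assume w: "w |\<in>| options (P' + K)" "w \<doteq> Q + K"
      from w(1) show False
        by (cases rule: options_plusE) (use w(2) a descent in auto)
    qed
  qed
  show "G \<doteq> H"
  proof (rule game_eqI)
    \<comment> \<open>Options do not decide the comparison with \<open>0\<close>; here
      \<open>K = H + K\<close> yields \<open>H = 0\<close>.\<close>
    show "\<not> P_position H" if "G = 0"
      using plus_eq_selfD[of K H] GK that game_eq_sym[of K "H + K"] game_eq_P_position[of H 0]
      by (auto simp: add.commute)
    show "\<not> P_position G" if "H = 0"
      using plus_eq_selfD[of K G] GK that game_eq_P_position[of G 0]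
      by (auto simp: add.commute)
  qed (use half[of G H] half[of H G] in simp_all)
qed

section \<open>Association classes as a cancellative monoid\<close>

lemma is_game_unit_iff: "is_game_unit U \<longleftrightarrow> U \<doteq> 0 \<or> U \<doteq> nim1"
proof
  assume "U \<doteq> 0 \<or> U \<doteq> nim1"
  then obtain u where "U \<doteq> u" "u + u \<doteq> 0" using nim1_plus_nim1 by auto
  then show "is_game_unit U"
    unfolding is_game_unit_def by (meson game_eq_plus_right game_eq_trans)
qed (use unit_cases in \<open>auto simp: is_game_unit_def\<close>)

lemma associates_iff: "G \<approx> H \<longleftrightarrow> G \<doteq> H \<or> G \<doteq> H + nim1"
proof
  assume "G \<approx> H"
  then obtain U where U: "U \<doteq> 0 \<or> U \<doteq> nim1" "G \<doteq> H + U"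
    by (auto simp: associates_def is_game_unit_iff)
  then have "H + U \<doteq> H + 0 \<or> H + U \<doteq> H + nim1" by (blast intro: game_eq_plus game_eq_refl)
  then show "G \<doteq> H \<or> G \<doteq> H + nim1" using U(2) game_eq_trans[OF U(2)] by auto
next
  assume "G \<doteq> H \<or> G \<doteq> H + nim1"
  then have "G \<doteq> H + 0 \<or> G \<doteq> H + nim1" by simp
  then show "G \<approx> H" unfolding associates_def is_game_unit_iff using game_eq_refl by blast
qed

lemma game_eq_plus_nim1_iff: "G \<doteq> H + nim1 \<longleftrightarrow> G + nim1 \<doteq> H"
proof -
  have H: "H + nim1 + nim1 \<doteq> H" for H
    using game_eq_plus[OF game_eq_refl nim1_plus_nim1, of H] by (simp add: add.assoc)
  show ?thesis
  proof
    assume "G \<doteq> H + nim1"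
    then show "G + nim1 \<doteq> H" by (rule game_eq_trans[OF game_eq_plus_right H])
  next
    assume "G + nim1 \<doteq> H"
    then show "G \<doteq> H + nim1" by (rule game_eq_trans[OF game_eq_sym[OF H] game_eq_plus_right])
  qed
qed

lemma equivp_associates: "equivp (\<approx>)"
proof (rule equivpI)
  show "reflp (\<approx>)" by (auto simp: associates_iff reflp_def)
  show "symp (\<approx>)"
    unfolding associates_iff symp_def using game_eq_sym game_eq_plus_nim1_iff by blast
  show "transp (\<approx>)"
  proof (rule transpI)
    fix G H K assume "G \<approx> H" "H \<approx> K"
    then consider "G \<doteq> H" "H \<doteq> K \<or> H \<doteq> K + nim1" | "G \<doteq> H + nim1" "H \<doteq> K"
      | "G \<doteq> H + nim1" "H + nim1 \<doteq> K"
      by (auto simp: associates_iff game_eq_plus_nim1_iff)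
    then show "G \<approx> K"
      unfolding associates_iff using game_eq_trans game_eq_plus_right[of H K nim1] by cases metis+
  qed
qed

quotient_type gclass = game / "(\<approx>)"
  morphisms rep_gclass cls
  by (rule equivp_associates)

lemma cls_eq_associates: "cls G = cls H \<longleftrightarrow> G \<approx> H"
  by (rule gclass.abs_eq_iff)

lemma cls_eq_iff: "cls G = cls H \<longleftrightarrow> G \<doteq> H \<or> G \<doteq> H + nim1"
  by (simp add: cls_eq_associates associates_iff)

lemma cls_eqI: "G \<doteq> H \<Longrightarrow> cls G = cls H"
  by (simp add: cls_eq_iff)

instantiation gclass :: "{zero, plus}"
begin

lift_definition zero_gclass :: gclass is 0 .

lift_definition plus_gclass :: "gclass \<Rightarrow> gclass \<Rightarrow> gclass" is "(+)"
proof -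
  fix G G' H H' assume "G \<approx> G'" "H \<approx> H'"
  then obtain U V where UV: "U \<doteq> 0 \<or> U \<doteq> nim1" "G \<doteq> G' + U" "V \<doteq> 0 \<or> V \<doteq> nim1" "H \<doteq> H' + V"
    by (auto simp: associates_def is_game_unit_iff)
  have "U + V \<doteq> 0 + 0 \<or> U + V \<doteq> nim1 + 0 \<or> U + V \<doteq> 0 + nim1 \<or> U + V \<doteq> nim1 + nim1"
    using UV(1,3) game_eq_plus by blast
  then have "is_game_unit (U + V)"
    using game_eq_trans[OF _ nim1_plus_nim1] by (auto simp: is_game_unit_iff)
  moreover have "G + H \<doteq> G' + H' + (U + V)"
    using game_eq_plus[OF UV(2,4)] by (simp add: add_ac)
  ultimately show "G + H \<approx> G' + H'" by (auto simp: associates_def)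
qed

instance ..

end

lemma cls_plus: "cls (G + H) = cls G + cls H"
  by (simp add: plus_gclass.abs_eq)

lemma cls_zero [simp]: "cls 0 = 0"
  by (simp add: zero_gclass_def)

lemma cls_induct [case_names cls]: "(\<And>G. P (cls G)) \<Longrightarrow> P c"
  by (induction c) simp

instance gclass :: "{comm_monoid_add, cancel_semigroup_add}"
proof
  fix a b c :: gclass
  show "a + b + c = a + (b + c)" by transfer (simp add: add.assoc associates_iff)
  have comm: "a + b = b + a" for a b :: gclass
    by transfer (simp add: add.commute associates_iff)
  show "a + b = b + a" by (rule comm)
  show "0 + a = a" by transfer (simp add: associates_iff)
  have *: "b = c" if "b + a = c + a" for a b c :: gclass
    using that
  proof (transfer)
    fix G H K assume "H + G \<approx> K + G"
    then have "H + G \<doteq> K + G \<or> H + G \<doteq> (K + nim1) + G" by (simp add: associates_iff add_ac)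
    then show "H \<approx> K" using game_plus_cancel by (auto simp: associates_iff)
  qed
  show "b = c" if "b + a = c + a" using * that .
  show "b = c" if "a + b = a + c" using *[of b a c] that
    by (simp add: comm)
qed

section \<open>Options and birthdays of association classes\<close>

text \<open>Minimality ranges over the whole association class, so neither an option of the
  representative nor an option of such an option can fall back into the class.\<close>

definition rep :: "gclass \<Rightarrow> game" where
  "rep c = (ARG_MIN formal_birthday G. cls G = c)"

definition bday :: "gclass \<Rightarrow> nat" where
  "bday c = formal_birthday (rep c)"

text \<open>The choice of representative does not affect this set: every game of the class has
  options in all of these classes, so any two minimal representatives yield the same ones.\<close>

definition opts :: "gclass \<Rightarrow> gclass set" where
  "opts c = cls ` fset (options (rep c))"

lemma cls_rep [simp]: "cls (rep c) = c"
proof -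
  obtain G where "cls G = c" by (induction c rule: cls_induct) blast
  then show ?thesis unfolding rep_def by (rule arg_min_natI)
qed

lemma bday_cls_le: "bday (cls G) \<le> formal_birthday G"
  unfolding bday_def rep_def by (rule arg_min_nat_le) simp

lemma bday_opts_less: "o' \<in> opts c \<Longrightarrow> bday o' < bday c"
  unfolding opts_def bday_def[of c]
  using le_less_trans[OF bday_cls_le formal_birthday_less] by blast

lemma cls_rep_option_neq: "x |\<in>| options (rep c) \<Longrightarrow> cls x \<noteq> c"
  using bday_opts_less[of "cls x" c] by (auto simp: opts_def)

lemma cls_rep_option2_neq: "x |\<in>| options (rep c) \<Longrightarrow> y |\<in>| options x \<Longrightarrow> cls y \<noteq> c"
  using bday_cls_le[of y] formal_birthday_less[of y x] formal_birthday_less[of x "rep c"]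
  by (auto simp: bday_def)

lemma rep_zero: "rep 0 = 0"
proof -
  have "bday 0 \<le> formal_birthday 0" using bday_cls_le[of 0] by simp
  then have "options (rep 0) = {||}"
    using formal_birthday_less[of _ "rep 0"] by (fastforce simp: bday_def zero_game_def)
  then show ?thesis by (simp add: options_empty_iff)
qed

lemma opts_empty_iff: "opts c = {} \<longleftrightarrow> c = 0"
proof
  assume "opts c = {}"
  then have "options (rep c) = {||}" by (auto simp: opts_def)
  then show "c = 0" by (metis cls_rep cls_zero options_empty_iff)
qed (simp add: opts_def rep_zero)

lemma opts_zero [simp]: "opts 0 = {}"
  by (simp add: opts_empty_iff)

lemma cls_eqE:
  assumes "cls G = cls H"
  obtains u where "u = 0 \<or> u = nim1" "G \<doteq> H + u"
  using assms that[of 0] that[of nim1] by (auto simp: cls_eq_iff)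

lemma cls_unit [simp]: "cls nim1 = 0"
  using cls_eq_iff[of nim1 0] by simp

text \<open>When an option \<open>w\<close> of the representative is matched inside
  \<open>G + u\<close>, with \<open>u\<close> a unit, only options of \<open>G\<close> remain: a
  reversal of \<open>w\<close> or a move in \<open>u\<close> would lead back into the class of
  \<open>G\<close>, against minimality.\<close>

lemma opts_clsE:
  assumes "o' \<in> opts (cls G)"
  obtains G' where "G' |\<in>| options G" "cls G' = o'"
proof -
  let ?c = "cls G"
  obtain w where w: "w |\<in>| options (rep ?c)" "cls w = o'" using assms by (auto simp: opts_def)
  obtain u where u: "u = 0 \<or> u = nim1" "rep ?c \<doteq> G + u"
    by (rule cls_eqE[of "rep ?c" G]) auto
  have "\<not> (y |\<in>| options w \<and> y \<doteq> G + u)" for y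
    using cls_rep_option2_neq[OF w(1), of y] u cls_eqI[of y "G + u"] by (auto simp: cls_plus)
  then obtain y where y: "y |\<in>| options (G + u)" "w \<doteq> y"
    using game_eq_option[OF u(2) w(1)] by blast
  from y(1) show ?thesis
  proof (cases rule: options_plusE)
    case (1 G')
    then show ?thesis using that[of G'] u(1) y(2) w(2) cls_eqI[of w y] by (auto simp: cls_plus)
  next
    case (2 u')
    then have "cls w = ?c" using u(1) y(2) cls_eqI[of w y] by auto
    then show ?thesis using cls_rep_option_neq[OF w(1)] by simp
  qed
qed

lemma cls_option_cases:
  assumes "G' |\<in>| options G"
  shows "cls G' \<in> opts (cls G) \<or> cls G' = cls G \<or> (\<exists>G''. G'' |\<in>| options G' \<and> cls G'' = cls G)"
proof -
  let ?c = "cls G"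
  obtain u where u: "u = 0 \<or> u = nim1" "rep ?c \<doteq> G + u"
    by (rule cls_eqE[of "rep ?c" G]) auto
  have cu [simp]: "cls u = 0" using u(1) by auto
  from game_eq_option[OF game_eq_sym[OF u(2)] options_plusI1[OF assms]] show ?thesis
  proof (elim disjE exE conjE)
    fix w assume "w |\<in>| options (rep ?c)" "G' + u \<doteq> w"
    then show ?thesis using cls_eqI[of "G' + u" w] by (auto simp: cls_plus opts_def)
  next
    fix w assume w: "w |\<in>| options (G' + u)" "w \<doteq> rep ?c"
    then have cw: "cls w = ?c" using cls_eqI[of w "rep ?c"] by simp
    from w(1) show ?thesis
      by (cases rule: options_plusE) (use cw u(1) in \<open>auto simp: cls_plus\<close>)
  qed
qed

lemma opts_plusD:
  assumes "o' \<in> opts (a + b)"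
  shows "(\<exists>a'\<in>opts a. o' = a' + b) \<or> (\<exists>b'\<in>opts b. o' = a + b')"
proof -
  have "o' \<in> opts (cls (rep a + rep b))" using assms by (simp add: cls_plus)
  then obtain w where w: "w |\<in>| options (rep a + rep b)" "cls w = o'" by (rule opts_clsE)
  from w(1) show ?thesis
    by (cases rule: options_plusE) (use w(2) in \<open>auto simp: cls_plus opts_def\<close>)
qed

text \<open>Cancellation and minimality eliminate every reversal of \<open>a' + b\<close> inside the
  first summand; only a reply in \<open>b\<close> is left.\<close>

lemma opts_plusI:
  assumes "a' \<in> opts a"
  shows "a' + b \<in> opts (a + b) \<or> (\<exists>b'\<in>opts b. a' + b' = a + b)"
proof -
  obtain x where x: "x |\<in>| options (rep a)" "cls x = a'" using assms by (auto simp: opts_def)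
  have "cls y \<noteq> a" if "y |\<in>| options x" for y using cls_rep_option2_neq[OF x(1) that] .
  moreover have "a' \<noteq> a" using cls_rep_option_neq[OF x(1)] x(2) by simp
  ultimately show ?thesis
    using cls_option_cases[OF options_plusI1[OF x(1), of "rep b"]] x(2)
    by (auto simp: cls_plus opts_def elim!: options_plusE)
qed

lemma gclass_plus_eq_0D: "a + b = (0::gclass) \<Longrightarrow> a = 0"
proof (induction a rule: cls_induct, induction b rule: cls_induct)
  case (cls H G)
  then have "G + H \<doteq> 0 \<or> G + H \<doteq> 0 + nim1"
    by (simp only: cls_plus[symmetric] cls_zero[symmetric] cls_eq_iff)
  then have "G + H \<doteq> 0 \<or> G + (H + nim1) \<doteq> 0"
    using game_eq_plus_nim1_iff[of "G + H" 0] by (simp add: add.assoc)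
  then show ?case using unit_cases cls_eq_iff[of G 0] by auto
qed

definition part :: "gclass \<Rightarrow> gclass \<Rightarrow> bool" where
  "part y c \<longleftrightarrow> (\<exists>z. c = z + y)"

text \<open>\<open>G - Y\<close> exists once every \<open>G' - Y\<close> and every \<open>G - Y'\<close> does: it can be taken to have precisely
  these options, since all further options of the sum with \<open>Y\<close> revert to \<open>G\<close>.\<close>

lemma part_if_opts:
  assumes "c \<noteq> 0" "\<And>c'. c' \<in> opts c \<Longrightarrow> part y c'" "\<And>y'. y' \<in> opts y \<Longrightarrow> part y' c"
  shows "part y c"
proof -
  let ?Y = "rep y" let ?G = "rep c"
  have lift: "\<exists>z. z + rep b \<doteq> x" if "part b (cls x)" for b x
  proof -
    from that obtain a where "cls x = a + b" by (auto simp: part_def)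
    then have "cls x = cls (rep a + rep b)" by (simp add: cls_plus)
    then obtain u where "x \<doteq> (rep a + u) + rep b"
      by (auto simp: cls_eq_iff add_ac) (metis add_0 add.commute add.left_commute)+
    then show ?thesis using game_eq_sym by blast
  qed
  have "\<exists>z. z + ?Y \<doteq> x" if "x |\<in>| options ?G" for x
    using lift assms(2) that by (auto simp: opts_def)
  then obtain z where z: "\<And>x. x |\<in>| options ?G \<Longrightarrow> z x + ?Y \<doteq> x" by metis
  have "\<exists>w. w + x \<doteq> ?G" if x: "x |\<in>| options ?Y" for x
  proof -
    have "part (cls x) (cls ?G)" using assms(3) x by (auto simp: opts_def)
    then obtain w where w: "w + rep (cls x) \<doteq> ?G" using lift by blast
    obtain u where "rep (cls x) \<doteq> x + u"
      by (rule cls_eqE[of "rep (cls x)" x]) auto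
    then have "w + rep (cls x) \<doteq> w + (x + u)" by (intro game_eq_plus) simp
    then have "(w + u) + x \<doteq> ?G"
      using game_eq_trans[OF game_eq_sym w] by (simp add: add_ac)
    then show ?thesis by blast
  qed
  then obtain w where w: "\<And>x. x |\<in>| options ?Y \<Longrightarrow> w x + x \<doteq> ?G" by metis
  define A where "A = Game (z |`| options ?G |\<union>| w |`| options ?Y)"
  have A: "options A = z |`| options ?G |\<union>| w |`| options ?Y" by (simp add: A_def)
  have ne: "options ?G \<noteq> {||}" using assms(1) by (metis options_empty_iff cls_rep cls_zero)
  have "A + ?Y \<doteq> ?G"
  proof (rule game_eqI)
    fix x assume "x |\<in>| options (A + ?Y)"
    then show "(\<exists>H'. H' |\<in>| options ?G \<and> x \<doteq> H') \<or> (\<exists>x'. x' |\<in>| options x \<and> x' \<doteq> ?G)"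
    proof (cases rule: options_plusE)
      case (1 A')
      then show ?thesis using z w by (auto simp: A intro: options_plusI2)
    next
      case (2 Y')
      then have "w Y' + Y' |\<in>| options x" by (auto simp: A intro: options_plusI1)
      then show ?thesis using w 2 by blast
    qed
  next
    fix x assume "x |\<in>| options ?G"
    then have "z x + ?Y |\<in>| options (A + ?Y)" "x \<doteq> z x + ?Y"
      using z game_eq_sym by (auto simp: A intro: options_plusI1)
    then show "(\<exists>G'. G' |\<in>| options (A + ?Y) \<and> x \<doteq> G') \<or> (\<exists>x'. x' |\<in>| options x \<and> x' \<doteq> A + ?Y)"
      by blast
  next
    have "A + ?Y \<noteq> 0" "?G \<noteq> 0"
      using ne by (auto simp: options_plus_empty_iff A simp flip: options_empty_iff)
    then show "A + ?Y = 0 \<Longrightarrow> \<not> P_position ?G" "?G = 0 \<Longrightarrow> \<not> P_position (A + ?Y)" by auto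
  qed
  then have "c = cls A + y" using cls_eqI by (fastforce simp: cls_plus)
  then show ?thesis by (auto simp: part_def)
qed

text \<open>\<open>rep c\<close> is an option of \<open>rep c + 1\<close>, and any game equal to the
  latter must have an option equal to \<open>rep c\<close>.\<close>

lemma formal_birthday_rep_nim1:
  assumes "x \<doteq> rep c + nim1"
  shows "bday c < formal_birthday x"
proof -
  have cx: "cls x = c" using cls_eqI[OF assms] by (simp add: cls_plus)
  have "rep c |\<in>| options (rep c + nim1)" using options_plusI2[of 0 nim1 "rep c"] by simp
  from game_eq_option[OF game_eq_sym[OF assms] this] obtain x' where x': "x' |\<in>| options x" "rep c \<doteq> x'"
    using cls_rep_option_neq[of _ c] cx cls_eqI by metis
  then have "cls x' = c" using cls_eqI by fastforce
  then show ?thesis using bday_cls_le[of x'] formal_birthday_less[OF x'(1)] by simp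
qed

section \<open>The classes of \<open>2\<close> and \<open>{2}\<close>, and all classes born by day
  3\<close>

definition two :: gclass where "two = cls nim2"
definition sub :: gclass where "sub = cls (Game {|nim2|})"

lemma nim1_neq_0: "\<not> nim1 \<doteq> 0"
  using game_eq_P_position[of nim1 0] by auto

lemma two_neq_0: "two \<noteq> 0"
proof -
  have "\<not> nim2 \<doteq> nim1"
    using game_eq_option[of nim2 nim1 nim1] nim1_neq_0 game_eq_sym[of 0 nim1] by auto
  then show ?thesis using nim2_neq_0 cls_eq_iff[of nim2 0] by (simp add: two_def)
qed

text \<open>Both \<open>rep q\<close> and \<open>rep q + 1\<close> are options of
  \<open>rep q + 2\<close>. Each is matched by an option of the representative of
  \<open>q + two\<close>, or it reverts, and then that representative occurs up to a unit among the
  options of \<open>rep q\<close>. Both go the same way because birthdays decrease, and the option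
  shifted by \<open>1\<close> accounts for the second day.\<close>

lemma plus_two_cases:
  "q \<in> opts (q + two) \<and> bday q + 2 \<le> bday (q + two) \<or>
   q + two \<in> opts q \<and> bday (q + two) + 2 \<le> bday q"
proof -
  let ?x = "q + two"
  define below where "below a b \<longleftrightarrow> a \<in> opts b \<and> bday a + 2 \<le> bday b" for a b
  \<comment> \<open>The unit \<open>d\<close> is kept explicit because the two relevant options lie
    in one class and only the shift tells them apart.\<close>
  define R where "R a b d \<longleftrightarrow> (\<exists>w. w |\<in>| options (rep b) \<and> w \<doteq> rep a + d)" for a b d
  have below: "below a b" if "R a b 0" "R a b nim1" for a b
  proof -
    from that obtain v w where vw: "v |\<in>| options (rep b)" "v \<doteq> rep a"
        "w |\<in>| options (rep b)" "w \<doteq> rep a + nim1"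
      by (auto simp: R_def)
    have "cls v = a" using cls_eqI[OF vw(2)] by simp
    then have "a \<in> opts b" using vw(1) by (auto simp: opts_def)
    moreover have "bday a + 2 \<le> bday b"
      using formal_birthday_rep_nim1[OF vw(4)] formal_birthday_less[OF vw(3)] by (simp add: bday_def[of b])
    ultimately show ?thesis by (simp add: below_def)
  qed
  have R: "a \<in> opts b" if "R a b d" "d = 0 \<or> d = nim1" for a b d
  proof -
    from that(1) obtain w where w: "w |\<in>| options (rep b)" "w \<doteq> rep a + d" by (auto simp: R_def)
    then have "cls w = a" using cls_eqI[OF w(2)] that(2) by (auto simp: cls_plus)
    then show ?thesis using w(1) by (auto simp: opts_def)
  qed
  have "cls (rep ?x) = cls (rep q + nim2)" by (simp add: cls_plus two_def)
  then obtain e where e: "e = 0 \<or> e = nim1" "rep ?x \<doteq> rep q + nim2 + e" by (rule cls_eqE)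
  note two = two_neq_0
  have RR: "R q ?x f \<or> R ?x q f" if df: "d = 0 \<or> d = nim1" "d + e \<doteq> f" "f = 0 \<or> f = nim1" for d f
  proof -
    have ff: "f + f \<doteq> 0" using df(3) nim1_plus_nim1 by auto
    have d: "d |\<in>| options nim2" using df by auto
    have "rep q + (d + e) |\<in>| options (rep q + nim2 + e)"
      using options_plusI1[OF options_plusI2[OF d]] by (simp add: add.assoc)
    from game_eq_option[OF game_eq_sym[OF e(2)] this] show ?thesis
    proof (elim disjE exE conjE)
      fix w assume w: "w |\<in>| options (rep ?x)" "rep q + (d + e) \<doteq> w"
      have "rep q + (d + e) \<doteq> rep q + f" by (intro game_eq_plus df) simp
      then have "w \<doteq> rep q + f" using game_eq_trans[OF game_eq_sym[OF w(2)]] by blast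
      then show ?thesis using w(1) by (auto simp: R_def)
    next
      fix w assume w: "w |\<in>| options (rep q + (d + e))" "w \<doteq> rep ?x"
      have cw: "cls w = q + two" using cls_eqI[OF w(2)] by simp
      from w(1) show ?thesis
      proof (cases rule: options_plusE)
        case (1 q')
        have "q' + (f + f) \<doteq> q' + 0" by (intro game_eq_plus ff) simp
        then have "q' \<doteq> q' + f + f" using game_eq_sym by (simp add: add.assoc)
        also have "q' + f \<doteq> q' + (d + e)" by (intro game_eq_plus game_eq_sym[OF df(2)]) simp
        then have "q' + f + f \<doteq> q' + (d + e) + f" by (rule game_eq_plus_right)
        also have "q' + (d + e) + f \<doteq> rep ?x + f" using w(2) 1 by (intro game_eq_plus_right) simp
        finally show ?thesis using 1 by (auto simp: R_def)
      next
        case (2 v)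
        then have "cls v = 0" using df(1) e(1) by (auto simp: options_plus)
        then have "q + two = q + 0" using 2 cw by (simp add: cls_plus)
        then show ?thesis using two by (simp only: add_left_cancel)
      qed
    qed
  qed
  have "R q ?x f \<or> R ?x q f" if "f = 0 \<or> f = nim1" for f
  proof -
    have "\<exists>d. (d = 0 \<or> d = nim1) \<and> d + e \<doteq> f"
      using that e(1) nim1_plus_nim1 by (metis add_0 add.right_neutral game_eq_refl)
    then show ?thesis using RR that by blast
  qed
  then have "R q ?x 0 \<or> R ?x q 0" "R q ?x nim1 \<or> R ?x q nim1" by auto
  moreover have "\<not> (q \<in> opts ?x \<and> ?x \<in> opts q)" using bday_opts_less by (meson less_asym)
  ultimately have "below q ?x \<or> below ?x q" using below R by blast
  then show ?thesis by (simp add: below_def)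
qed

lemma opts_two: "opts two = {0}"
proof -
  have "opts two \<subseteq> {0}" by (auto simp: two_def elim!: opts_clsE)
  then show ?thesis using two_neq_0 opts_empty_iff by auto
qed

lemma sub_neq_0: "sub \<noteq> 0"
proof -
  let ?s = "Game {|nim2|}"
  have "\<not> ?s \<doteq> 0" using game_eq_P_position[of ?s 0] by auto
  moreover have "\<not> ?s \<doteq> nim1"
    using game_eq_option[of nim1 ?s 0] game_eq_sym[of 0 nim2] nim2_neq_0 game_eq_sym[of ?s nim1] by auto
  ultimately show ?thesis using cls_eq_iff[of ?s 0] by (simp add: sub_def)
qed

lemma opts_sub: "opts sub = {two}"
proof -
  have "opts sub \<subseteq> {two}" by (auto simp: sub_def two_def elim: opts_clsE)
  then show ?thesis using sub_neq_0 opts_empty_iff by auto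
qed

lemma formal_birthday_eq_0D: "formal_birthday G = 0 \<Longrightarrow> G = 0"
  using formal_birthday_less[of _ G] by (fastforce simp flip: options_empty_iff)

lemma formal_birthday_le_1D:
  assumes "formal_birthday G \<le> 1"
  shows "G \<doteq> 0 \<or> G \<doteq> nim1"
proof -
  have "x = 0" if "x |\<in>| options G" for x
    using formal_birthday_less[OF that] assms formal_birthday_eq_0D[of x] by simp
  then have "options G = {||} \<or> options G = {|0|}" by auto
  then have "G = 0 \<or> G = nim1" by (cases G) (auto simp: nim1_def zero_game_def)
  then show ?thesis by auto
qed

lemma formal_birthday_le_2D:
  assumes "formal_birthday G \<le> 2"
  shows "G \<doteq> 0 \<or> G \<doteq> nim1 \<or> G \<doteq> nim2"
proof (rule unit_options_cases)
  fix x assume "x |\<in>| options G"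
  then show "x \<doteq> 0 \<or> x \<doteq> nim1"
    using formal_birthday_less[of x G] assms by (intro formal_birthday_le_1D) simp
qed

lemma bday_le_1D: "bday c \<le> 1 \<Longrightarrow> c = 0"
  unfolding bday_def using formal_birthday_le_1D[of "rep c"] cls_eqI[of "rep c"] by fastforce

lemma opts_subset_0D:
  assumes "opts c \<subseteq> {0}"
  shows "c = 0 \<or> c = two"
proof -
  have "x \<doteq> 0 \<or> x \<doteq> nim1" if "x |\<in>| options (rep c)" for x
    using assms that cls_eq_iff[of x 0] by (auto simp: opts_def)
  then have "rep c \<doteq> 0 \<or> rep c \<doteq> nim1 \<or> rep c \<doteq> nim2" by (rule unit_options_cases)
  then show ?thesis unfolding two_def using cls_eqI[of "rep c"] by fastforce
qed

text \<open>With \<open>2\<close> among the options, reversals give \<open>{0, 2} = 1\<close> and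
  \<open>{1, 2} = 0\<close>, and \<open>{0, 1, 2}\<close> is \<open>2 + 1\<close>. In
  \<open>{2}\<close> the reversal to \<open>0\<close> is blocked by the outcome condition, as
  \<open>{2}\<close> is a P-position; this is how \<open>sub\<close> arises.\<close>

lemma bday_le_3D:
  assumes "bday c \<le> 3"
  shows "c = 0 \<or> c = two \<or> c = sub"
proof -
  let ?G = "rep c"
  have opt: "x \<doteq> 0 \<or> x \<doteq> nim1 \<or> x \<doteq> nim2" if "x |\<in>| options ?G" for x
    using formal_birthday_less[OF that] assms formal_birthday_le_2D[of x] by (simp add: bday_def)
  show ?thesis
  proof (cases "\<exists>x. x |\<in>| options ?G \<and> x \<doteq> nim2")
    case False
    then have "?G \<doteq> 0 \<or> ?G \<doteq> nim1 \<or> ?G \<doteq> nim2"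
      by (intro unit_options_cases) (use opt in blast)
    then show ?thesis unfolding two_def using cls_eqI[of ?G] by fastforce
  next
    case two: True
    define Z where "Z = (\<exists>x. x |\<in>| options ?G \<and> x \<doteq> 0)"
    define N where "N = (\<exists>x. x |\<in>| options ?G \<and> x \<doteq> nim1)"
    have eq: "?G \<doteq> Game ((if Z then {|0|} else {||}) |\<union>| (if N then {|nim1|} else {||}) |\<union>| {|nim2|})"
    proof (rule game_eq_if_same_opts, goal_cases)
      case (1 x)
      then show ?case using opt[of x] by (auto simp: Z_def N_def)
    next
      case (2 y)
      then show ?case using two by (auto simp: Z_def N_def split: if_splits)
    qed
    have "Game {|0, nim2|} \<doteq> nim1"
      by (rule game_eqI) (auto simp flip: options_empty_iff)
    moreover have "Game {|nim1, nim2|} \<doteq> 0"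
      by (rule game_eqI) (auto simp: P_position_iff[of "Game _"])
    moreover have "Game {|0, nim1, nim2|} \<doteq> nim2 + nim1"
    proof (rule game_eq_if_same_opts)
      have o': "options (nim2 + nim1) = {|nim2, nim1, nim1 + nim1|}"
        by (auto simp: options_plus)
      show "\<exists>H'. H' |\<in>| options (nim2 + nim1) \<and> G' \<doteq> H'"
        if "G' |\<in>| options (Game {|0, nim1, nim2|})" for G'
      proof (cases "G' = 0")
        case True
        then show ?thesis using o' game_eq_sym[OF nim1_plus_nim1] by blast
      next
        case False
        then have "G' |\<in>| options (nim2 + nim1)" using that o' by auto
        then show ?thesis using game_eq_refl by blast
      qed
      show "\<exists>G'. G' |\<in>| options (Game {|0, nim1, nim2|}) \<and> G' \<doteq> H'"
        if "H' |\<in>| options (nim2 + nim1)" for H'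
      proof (cases "H' = nim1 + nim1")
        case True
        then show ?thesis using game_eq_sym[OF nim1_plus_nim1] by auto
      next
        case False
        then have "H' |\<in>| options (Game {|0, nim1, nim2|})" using that o' by auto
        then show ?thesis using game_eq_refl by blast
      qed
    qed
    ultimately show ?thesis
      using cls_eqI[OF eq]
      by (cases Z; cases N) (auto simp: sub_def two_def cls_plus finsert_commute dest!: cls_eqI)
  qed
qed

lemma bday_two: "bday two = 2"
proof -
  have "formal_birthday nim1 = 1" by (simp add: nim1_def zero_game_def)
  then have "formal_birthday nim2 = 2" by (simp add: nim2_def zero_game_def)
  then show ?thesis
    using bday_cls_le[of nim2] bday_le_1D[of two] two_neq_0 by (fastforce simp: two_def)
qed

lemma bday_sub: "bday sub = 3"
proof -
  have "formal_birthday nim1 = 1" by (simp add: nim1_def zero_game_def)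
  then have "formal_birthday (Game {|nim2|}) = 3" by (simp add: nim2_def zero_game_def)
  then show ?thesis
    using bday_cls_le[of "Game {|nim2|}"] bday_opts_less[of two sub] opts_sub bday_two
    by (simp add: sub_def)
qed

section \<open>Factorizations\<close>

definition gprime :: "gclass \<Rightarrow> bool" where
  "gprime p \<longleftrightarrow> p \<noteq> 0 \<and> (\<forall>a b. p = a + b \<longrightarrow> a = 0 \<or> b = 0)"

definition factors :: "gclass \<Rightarrow> gclass multiset \<Rightarrow> bool" where
  "factors c F \<longleftrightarrow> (\<forall>p\<in>#F. gprime p) \<and> \<Sum>\<^sub># F = c"

definition unique_factors :: "gclass \<Rightarrow> bool" where
  "unique_factors c \<longleftrightarrow> (\<forall>F F'. factors c F \<longrightarrow> factors c F' \<longrightarrow> F = F')"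

definition composite :: "gclass \<Rightarrow> bool" where
  "composite c \<longleftrightarrow> c \<noteq> 0 \<and> \<not> gprime c"

lemma gclass_plus_eq_0_iff [simp]: "a + b = 0 \<longleftrightarrow> a = 0 \<and> b = (0::gclass)"
  using gclass_plus_eq_0D[of a b] gclass_plus_eq_0D[of b a] by (auto simp: add.commute)

lemma gclass_self_eq_plus_iff [simp]:
  fixes a b :: gclass
  shows "a = a + b \<longleftrightarrow> b = 0" "a = b + a \<longleftrightarrow> b = 0" "a + b = a \<longleftrightarrow> b = 0" "b + a = a \<longleftrightarrow> b = 0"
  using add_left_cancel[of a 0 b] add_left_cancel[of a b 0] by (auto simp: add.commute)

lemma gprime_nonzero: "gprime p \<Longrightarrow> p \<noteq> 0"
  by (simp add: gprime_def)

lemma compositeI: "a \<noteq> 0 \<Longrightarrow> b \<noteq> 0 \<Longrightarrow> composite (a + b)"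
  by (auto simp: composite_def gprime_def)

lemma compositeE:
  assumes "composite c"
  obtains a b where "c = a + b" "a \<noteq> 0" "b \<noteq> 0"
  using assms by (auto simp: composite_def gprime_def)

lemma factors_nonzero: "factors c F \<Longrightarrow> 0 \<notin># F"
  by (auto simp: factors_def gprime_def)

lemma factors_plus: "factors a F \<Longrightarrow> factors b F' \<Longrightarrow> factors (a + b) (F + F')"
  by (auto simp: factors_def)

lemma factors_gprime: "gprime p \<Longrightarrow> factors p {#p#}"
  by (simp add: factors_def)

lemma unique_factorsD: "unique_factors c \<Longrightarrow> factors c F \<Longrightarrow> factors c F' \<Longrightarrow> F = F'"
  by (auto simp: unique_factors_def)

lemma opts_sum_msetD:
  assumes "o' \<in> opts (\<Sum>\<^sub># F)"
  shows "\<exists>r r'. r \<in># F \<and> r' \<in> opts r \<and> o' = r' + \<Sum>\<^sub># (F - {#r#})"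
  using assms
proof (induction F arbitrary: o')
  case (add x F)
  from add.prems have "o' \<in> opts (x + \<Sum>\<^sub># F)" by simp
  from opts_plusD[OF this] show ?case
  proof (elim disjE bexE)
    fix b assume b: "b \<in> opts (\<Sum>\<^sub># F)" "o' = x + b"
    then obtain r r' where r: "r \<in># F" "r' \<in> opts r" "b = r' + \<Sum>\<^sub># (F - {#r#})"
      using add.IH by blast
    then have "add_mset x F - {#r#} = add_mset x (F - {#r#})" by simp
    then have "o' = r' + \<Sum>\<^sub># (add_mset x F - {#r#})"
      unfolding b(2) r(3) by (simp only: sum_mset.add_mset add.left_commute)
    moreover have "r \<in># add_mset x F" using r(1) by simp
    ultimately show ?thesis using r(2) by blast
  qed auto
qed simp

text \<open>A reversal involves only two summands; all others cancel, which leaves an equation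
  between a pair of factors.\<close>

lemma opts_sum_msetI:
  assumes "r \<in># F" "r' \<in> opts r"
  shows "r' + \<Sum>\<^sub># (F - {#r#}) \<in> opts (\<Sum>\<^sub># F) \<or>
    (\<exists>q q'. q \<in># F - {#r#} \<and> q' \<in> opts q \<and> r' + q' = r + q)"
proof -
  let ?A = "F - {#r#}"
  have F: "\<Sum>\<^sub># F = r + \<Sum>\<^sub># ?A" using assms(1) by (metis insert_DiffM sum_mset.add_mset)
  from opts_plusI[OF assms(2), of "\<Sum>\<^sub># ?A"] show ?thesis
  proof (elim disjE bexE)
    fix b assume b: "b \<in> opts (\<Sum>\<^sub># ?A)" "r' + b = r + \<Sum>\<^sub># ?A"
    obtain q q' where q: "q \<in># ?A" "q' \<in> opts q" "b = q' + \<Sum>\<^sub># (?A - {#q#})"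
      using opts_sum_msetD[OF b(1)] by blast
    have "\<Sum>\<^sub># ?A = q + \<Sum>\<^sub># (?A - {#q#})" using q(1) by (metis insert_DiffM sum_mset.add_mset)
    then have "(r' + q') + \<Sum>\<^sub># (?A - {#q#}) = (r + q) + \<Sum>\<^sub># (?A - {#q#})"
      using b(2) q(3) by (simp add: add.assoc)
    then show ?thesis using q by auto
  qed (simp add: F)
qed

text \<open>A move changes one summand, so it removes at most one, while the birthday drops. Hence
  there is a longest expression as a sum of nonzero classes, and its terms are prime.\<close>

lemma size_le_bday:
  assumes "0 \<notin># F"
  shows "size F \<le> bday (\<Sum>\<^sub># F)"
  using assms
proof (induction "bday (\<Sum>\<^sub># F)" arbitrary: F rule: less_induct)
  case less
  show ?case
  proof (cases "\<Sum>\<^sub># F = 0")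
    case True
    then have "F = {#}" using less.prems by (cases F) auto
    then show ?thesis by simp
  next
    case False
    then obtain o' where o': "o' \<in> opts (\<Sum>\<^sub># F)" using opts_empty_iff by blast
    then obtain r r' where r: "r \<in># F" "o' = r' + \<Sum>\<^sub># (F - {#r#})"
      using opts_sum_msetD by blast
    define E where "E = (if r' = 0 then F - {#r#} else add_mset r' (F - {#r#}))"
    have "\<Sum>\<^sub># E = o'" "0 \<notin># E" "size F \<le> Suc (size E)"
      using r less.prems by (auto simp: E_def size_Diff_singleton dest: in_diffD)
    moreover have "bday o' < bday (\<Sum>\<^sub># F)" using o' by (rule bday_opts_less)
    ultimately show ?thesis using less.hyps[of E] by auto
  qed
qed

lemma factors_exist: "\<exists>F. factors c F"
proof -
  define P where "P F \<longleftrightarrow> 0 \<notin># F \<and> \<Sum>\<^sub># F = c" for F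
  have "P (if c = 0 then {#} else {#c#})" by (simp add: P_def)
  moreover have "\<forall>F. P F \<longrightarrow> size F < Suc (bday c)"
    using size_le_bday by (auto simp: P_def less_Suc_eq_le)
  ultimately obtain F where F: "P F" "\<And>E. P E \<Longrightarrow> size E \<le> size F"
    using ex_has_greatest_nat[of P _ size] by blast
  have "gprime r" if r: "r \<in># F" for r
  proof (rule ccontr)
    assume "\<not> gprime r"
    then obtain a b where ab: "r = a + b" "a \<noteq> 0" "b \<noteq> 0"
      using F(1) r by (auto simp: P_def gprime_def)
    have "\<Sum>\<^sub># F = r + \<Sum>\<^sub># (F - {#r#})" using r by (metis insert_DiffM sum_mset.add_mset)
    then have "P (add_mset a (add_mset b (F - {#r#})))"
      using F(1) ab by (auto simp: P_def add.assoc dest: in_diffD)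
    from F(2)[OF this] show False using r size_Suc_Diff1[OF r] by simp
  qed
  then show ?thesis using F(1) by (auto simp: factors_def P_def)
qed

lemma sum_mset_eq_0D: "\<Sum>\<^sub># F = (0::gclass) \<Longrightarrow> 0 \<notin># F \<Longrightarrow> F = {#}"
  by (cases F) auto

lemma factors_of_gprime:
  assumes "gprime p" "\<Sum>\<^sub># F = p" "0 \<notin># F"
  shows "F = {#p#}"
proof (cases F)
  case empty
  then show ?thesis using assms by (auto simp: gprime_def)
next
  case (add a F')
  then have "p = a + \<Sum>\<^sub># F'" "a \<noteq> 0" using assms by auto
  then have "\<Sum>\<^sub># F' = 0" using assms(1) by (auto simp: gprime_def)
  then show ?thesis using sum_mset_eq_0D[of F'] assms add by auto
qed

lemma unique_factors_gprime: "gprime p \<Longrightarrow> unique_factors p"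
  unfolding unique_factors_def factors_def
  using factors_of_gprime by (metis factors_def factors_nonzero)

lemma unique_factors_0: "unique_factors 0"
  unfolding unique_factors_def using sum_mset_eq_0D factors_nonzero factors_def by metis

text \<open>Reaching \<open>x\<close> replaces a single factor \<open>r\<close> of \<open>g\<close>;
  the others belong to a factorization of \<open>x\<close>, of which there is only one.\<close>

lemma factors_option:
  assumes "x \<in> opts g" "unique_factors x" "factors x X" "factors g F"
  shows "\<exists>r. r \<in># F \<and> F - {#r#} \<subseteq># X"
proof -
  have "x \<in> opts (\<Sum>\<^sub># F)" using assms(1,4) by (simp add: factors_def)
  then obtain r r' where r: "r \<in># F" "x = r' + \<Sum>\<^sub># (F - {#r#})" using opts_sum_msetD by blast
  obtain R where R: "factors r' R" using factors_exist by blast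
  have "factors (\<Sum>\<^sub># (F - {#r#})) (F - {#r#})"
    using assms(4) by (auto simp: factors_def dest: in_diffD)
  then have "X = R + (F - {#r#})"
    using unique_factorsD[OF assms(2,3)] factors_plus[OF R] r(2) by blast
  then have "F - {#r#} \<subseteq># X" by (simp only: mset_subset_eq_add_right)
  then show ?thesis using r(1) by blast
qed

text \<open>A factorization of \<open>g\<close> is determined by its common part with the factorization of a single
  option, because at most one factor lies outside of it.\<close>

lemma factors_eqI:
  assumes x: "x \<in> opts g" "unique_factors x" "factors x X"
    and F: "factors g F" "factors g E" "F \<inter># X \<subseteq># E \<inter># X"
  shows "F = E"
proof -
  obtain r where r: "r \<in># F" "F - {#r#} \<subseteq># X" using factors_option[OF x F(1)] by blast
  have "F - {#r#} \<subseteq># F \<inter># X" using r(2) by simp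
  then have sub: "F - {#r#} \<subseteq># E" using F(3) by (meson subset_mset.inf.boundedE subset_mset.order_trans)
  have sumF: "\<Sum>\<^sub># F = g" and sumE: "\<Sum>\<^sub># E = g" using F by (auto simp: factors_def)
  obtain D where D: "E = (F - {#r#}) + D" using sub by (metis subset_mset.le_iff_add)
  have "\<Sum>\<^sub># F = r + \<Sum>\<^sub># (F - {#r#})" using r(1) by (metis insert_DiffM sum_mset.add_mset)
  then have "\<Sum>\<^sub># D = r" using sumF sumE D by (simp add: add.commute)
  moreover have "gprime r" using F(1) r(1) by (auto simp: factors_def)
  moreover have "0 \<notin># D" using factors_nonzero[OF F(2)] D by auto
  ultimately have "D = {#r#}" using factors_of_gprime by blast
  then show ?thesis using D r(1) by simp
qed

text \<open>\<open>L\<close> is meant to list the factors of \<open>x\<close> in the order of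
  absorption. Prefixes are nested, and nested common parts already force factorizations to
  coincide.\<close>

lemma unique_factors_chain:
  assumes x: "x \<in> opts g" "unique_factors x" "factors x (mset L)"
    and L: "\<And>F. factors g F \<Longrightarrow> \<exists>k. F \<inter># mset L = mset (take k L)"
  shows "unique_factors g"
  unfolding unique_factors_def
proof (intro allI impI)
  have mono: "mset (take i L) \<subseteq># mset (take j L)" if "i \<le> j" for i j
  proof -
    have "take j L = take i L @ take (j - i) (drop i L)" using that take_add[of i "j - i" L] by simp
    then show ?thesis by simp
  qed
  fix F E assume FE: "factors g F" "factors g E"
  obtain i j where "F \<inter># mset L = mset (take i L)" "E \<inter># mset L = mset (take j L)"
    using L FE by blast
  then have "F \<inter># mset L \<subseteq># E \<inter># mset L \<or> E \<inter># mset L \<subseteq># F \<inter># mset L"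
    using mono[of i j] mono[of j i] by (metis nat_le_linear)
  then show "F = E" using factors_eqI[OF x] FE by blast
qed

text \<open>Some factorization of \<open>g\<close> contains all factors of \<open>x\<close>; its
  common part with them is the largest possible, so every other factorization compares with
  it.\<close>

lemma unique_factors_if_option_part:
  assumes "x \<in> opts g" "unique_factors x" "part x g"
  shows "unique_factors g"
proof -
  obtain u where u: "g = u + x" using assms(3) by (auto simp: part_def)
  obtain X R where XR: "factors x X" "factors u R" using factors_exist by meson
  then have RX: "factors g (R + X)" using u factors_plus by blast
  have "F = R + X" if "factors g F" for F
    by (rule factors_eqI[OF assms(1,2) XR(1) that RX])
      (simp add: subset_mset.inf.absorb2)
  then show ?thesis by (auto simp: unique_factors_def)
qed

text \<open>A move to \<open>0\<close> in a sum requires the untouched summand to be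
  \<open>0\<close>.\<close>

lemma zero_option_gprime: "0 \<in> opts c \<Longrightarrow> gprime c"
  unfolding gprime_def by (auto dest: opts_plusD)

lemma composite_option_nonzero: "composite c \<Longrightarrow> x \<in> opts c \<Longrightarrow> x \<noteq> 0"
  using zero_option_gprime by (auto simp: composite_def)

lemma gprime_option_plus:
  assumes "p \<in> opts (a + b)" "gprime p" "a \<noteq> 0" "b \<noteq> 0"
  shows "a = p \<and> 0 \<in> opts b \<or> b = p \<and> 0 \<in> opts a"
  using opts_plusD[OF assms(1)] assms(2-4) unfolding gprime_def by (metis add.left_neutral add.right_neutral)

lemma unique_factors_gprime_option:
  assumes "p \<in> opts c" "gprime p"
  shows "unique_factors c"
proof (rule unique_factors_chain[where L = "[p]", OF assms(1)])
  show "\<exists>k. F \<inter># mset [p] = mset (take k [p])" for F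
    by (cases "p \<in># F") (auto intro: exI[of _ 0] exI[of _ 1] simp: inter_add_left1 inter_add_left2
        inter_add_right1 inter_add_right2)
qed (use assms in \<open>simp_all add: unique_factors_gprime factors_gprime\<close>)

text \<open>Moving \<open>r\<close> to \<open>r + y\<close> turns \<open>g\<close> into
  \<open>g + y\<close>. As this is no option of \<open>g\<close>, a reply at another factor
  \<open>q\<close> reverts it; cancelling \<open>r\<close> leaves \<open>q = y + q'\<close> with
  \<open>q\<close> prime.\<close>

lemma absorbed_factor:
  assumes "factors g F" "r \<in># F" "r + y \<in> opts r" "y \<noteq> 0" "g + y \<notin> opts g"
  shows "y \<in># F - {#r#}"
proof -
  have "\<Sum>\<^sub># F = g" using assms(1) by (simp add: factors_def)
  moreover have "\<Sum>\<^sub># F = r + \<Sum>\<^sub># (F - {#r#})" using assms(2) by (metis insert_DiffM sum_mset.add_mset)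
  ultimately have "r + y + \<Sum>\<^sub># (F - {#r#}) = g + y" by (metis add.assoc add.commute)
  then obtain q q' where q: "q \<in># F - {#r#}" "r + y + q' = r + q"
    using opts_sum_msetI[OF assms(2,3)] assms(5) \<open>\<Sum>\<^sub># F = g\<close> by auto
  then have "q = y + q'" by (simp add: add.assoc)
  moreover have "gprime q" using q(1) assms(1) by (auto simp: factors_def dest: in_diffD)
  ultimately have "q = y" using assms(4) by (auto simp: gprime_def)
  then show ?thesis using q(1) by simp
qed

section \<open>Classes born by day 5\<close>

lemma part_refl [simp]: "part y y"
  by (auto simp: part_def intro: exI[of _ 0])

lemma part_0 [simp]: "part 0 y"
  by (simp add: part_def)

lemma part_plus: "part y (z + y)" "part y (y + z)"
  by (auto simp: part_def add.commute)

lemma part_trans: "part x y \<Longrightarrow> part y z \<Longrightarrow> part x z"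
  by (auto simp: part_def) (metis add.assoc)

lemma part_plus_left: "part x y \<Longrightarrow> part x (y + z)"
  using part_trans part_plus(2) by blast

lemma gprime_two: "gprime two"
  by (rule zero_option_gprime) (simp add: opts_two)

lemma part_twoI:
  assumes "c \<noteq> 0" "\<And>x. x \<in> opts c \<Longrightarrow> part two x"
  shows "part two c"
  by (rule part_if_opts) (use assms in \<open>auto simp: opts_two\<close>)

lemma part_two_sub: "part two sub"
  by (rule part_twoI) (auto simp: opts_sub sub_neq_0)

text \<open>The difference of \<open>sub\<close> and \<open>two\<close>, determined uniquely by
  cancellation.\<close>

definition subq :: gclass where "subq = (SOME a. sub = a + two)"

lemma sub_eq: "sub = subq + two"
  unfolding subq_def using part_two_sub unfolding part_def by (rule someI_ex)

text \<open>The only option of \<open>sub\<close> is \<open>two\<close>, born just one day earlier;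
  so in the dichotomy for adding \<open>two\<close>, it is \<open>subq\<close> that comes
  later.\<close>

lemma sub_option_subq: "sub \<in> opts subq" and bday_subq: "5 \<le> bday subq"
proof -
  have "\<not> (subq \<in> opts sub \<and> bday subq + 2 \<le> bday sub)"
    using bday_sub bday_two by (auto simp: opts_sub)
  then show "sub \<in> opts subq" "5 \<le> bday subq"
    using plus_two_cases[of subq] bday_sub unfolding sub_eq[symmetric] by auto
qed

lemma subq_neq [simp]: "subq \<noteq> 0" "subq \<noteq> two" "two \<noteq> subq"
  using bday_subq bday_two sub_option_subq by auto

lemma gprime_subq: "gprime subq"
  using gprime_option_plus[of two subq two] gprime_two two_neq_0
  by (auto simp: opts_sub zero_option_gprime simp flip: sub_eq)

lemma composite_sub: "composite sub"
  unfolding sub_eq by (simp add: compositeI two_neq_0)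

lemma factors_sub: "factors sub {#two, subq#}"
  using gprime_two gprime_subq by (auto simp: factors_def sub_eq add.commute)

lemma unique_factors_sub: "unique_factors sub"
  by (rule unique_factors_gprime_option[of two]) (simp_all add: opts_sub gprime_two)

section \<open>Small classes, which comprise the composite classes born by day 4\<close>

definition small :: "gclass \<Rightarrow> bool" where
  "small c \<longleftrightarrow> opts c \<noteq> {} \<and> opts c \<subseteq> {two, sub}"

lemma small_sub: "small sub"
  by (simp add: small_def opts_sub)

lemma small_neq [simp]: "small c \<Longrightarrow> c \<noteq> 0" "small c \<Longrightarrow> c \<noteq> two"
  using two_neq_0 sub_neq_0 by (auto simp: small_def opts_two)

lemma small_part_two: "small c \<Longrightarrow> part two c"
  by (rule part_twoI) (use part_two_sub in \<open>auto simp: small_def\<close>)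

lemma smallE:
  assumes "small c"
  obtains e where "c = two + e" "e \<noteq> 0"
proof -
  obtain e where "c = e + two" using small_part_two[OF assms] by (auto simp: part_def)
  then show ?thesis using that[of e] small_neq(2)[OF assms] by (auto simp: add.commute)
qed

lemma small_composite: "small c \<Longrightarrow> composite c"
  by (erule smallE) (simp add: compositeI two_neq_0)

lemma small_not_gprime: "small c \<Longrightarrow> \<not> gprime c"
  using small_composite by (simp add: composite_def)

lemma bday_le_4_small:
  assumes "bday c \<le> 4" "c \<noteq> 0" "0 \<notin> opts c"
  shows "small c"
proof -
  have "x = two \<or> x = sub" if "x \<in> opts c" for x
    using bday_opts_less[OF that] assms bday_le_3D[of x] that by auto
  then show ?thesis using assms by (auto simp: small_def opts_empty_iff)
qed

lemma composite_bday_le_4: "composite c \<Longrightarrow> bday c \<le> 4 \<Longrightarrow> small c"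
  using bday_le_4_small zero_option_gprime by (auto simp: composite_def)

lemma two_option_gprime:
  assumes "two \<in> opts (two + e)" "e \<noteq> 0"
  shows "gprime e"
  using gprime_option_plus[OF assms(1) gprime_two two_neq_0 assms(2)] gprime_two zero_option_gprime by auto

lemma two_not_option: "a \<noteq> 0 \<Longrightarrow> b \<noteq> 0 \<Longrightarrow> two \<notin> opts (two + a + b)"
  using two_option_gprime[of "a + b"] compositeI[of a b] by (auto simp: composite_def add.assoc)

text \<open>\<open>sub\<close> divides the option of \<open>t\<close>, and its own option
  \<open>two\<close> divides \<open>t\<close>; so \<open>sub\<close> divides \<open>t\<close>. The
  remaining factor \<open>U\<close> has the option \<open>0\<close> because \<open>sub\<close> must
  be reachable from \<open>sub + U\<close>, and the option \<open>U + subq\<close> because the move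
  of \<open>sub\<close> to \<open>two\<close> has to be reverted.\<close>

lemma opts_sub_singletonE:
  assumes t: "opts t = {sub}"
  obtains U where "t = sub + U" "gprime U" "U \<noteq> two" "U \<noteq> subq" "U + two \<notin> opts U"
    "opts U \<subseteq> {0, subq + U}" "U + subq \<in> opts U" "factors t {#two, subq, U#}" "unique_factors t"
proof -
  have t0: "t \<noteq> 0" using t by auto
  have "part two t" by (rule part_twoI) (use t t0 part_two_sub in auto)
  then have "part sub t" 
    by (intro part_if_opts[of t sub]) (use t t0 in \<open>auto simp: opts_sub\<close>)
  then obtain U where U: "t = sub + U" by (auto simp: part_def add.commute)
  have neq: "U \<noteq> subq"
  proof
    assume "U = subq"
    then have "sub + sub \<in> opts (subq + sub) \<or> (\<exists>b\<in>opts sub. sub + b = subq + sub)" "t = subq + sub"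
      using opts_plusI[OF sub_option_subq, of sub] U by (auto simp: add.commute)
    then show False
      using t sub_neq_0 by (auto simp: opts_sub add.commute[of subq sub])
  qed
  have two_opt: "two + b \<in> opts (sub + b) \<or> (\<exists>b'\<in>opts b. two + b' = sub + b)" for b
    using opts_plusI[of two sub b] by (simp add: opts_sub)
  have two': "two + b' = sub + b \<longleftrightarrow> b' = subq + b" for b b'
  proof -
    have "sub + b = two + (subq + b)" by (simp only: sub_eq ac_simps)
    then show ?thesis by simp
  qed
  have "U \<noteq> two"
  proof
    assume "U = two"
    then have "opts (sub + two) = {sub}" using t unfolding U by simp
    then have "two + two \<in> {sub} \<or> two + 0 = sub + two"
      using two_opt[of two] unfolding opts_two by blast
    moreover have "two + two \<noteq> sub" by (simp add: sub_eq)
    moreover have "two + 0 \<noteq> sub + two" by (simp add: sub_neq_0)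
    ultimately show False by blast
  qed
  have "sub \<in> opts (sub + U)" using t U by simp
  from opts_plusD[OF this] have "0 \<in> opts U"
    using neq by (auto simp: opts_sub) (metis add.commute add_left_cancel sub_eq)
  then have prime: "gprime U" by (rule zero_option_gprime)
  have "U + two \<notin> opts U"
  proof
    assume "U + two \<in> opts U"
    from opts_plusI[OF this, of sub] have "U + two + sub = sub \<or> U + two + two = U + sub"
      using t U by (auto simp: opts_sub add.commute)
    moreover have "U + two + sub \<noteq> sub" by (simp add: two_neq_0)
    moreover have "U + two + two \<noteq> U + sub" by (simp add: sub_eq add.assoc)
    ultimately show False by blast
  qed
  moreover have "u = 0 \<or> u = subq + U" if "u \<in> opts U" for u
    using opts_plusI[OF that, of sub] t U two'[of u U]
    by (auto simp: opts_sub add.commute[of U] add.commute[of u])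
  moreover have "U + subq \<in> opts U"
  proof -
    have "two + U \<noteq> sub" using neq by (simp add: sub_eq add.commute[of two])
    moreover have "two + U \<in> {sub} \<or> (\<exists>b'\<in>opts U. b' = subq + U)"
      using two_opt[of U] t unfolding two' U by simp
    ultimately show ?thesis by (metis add.commute singletonD)
  qed
  moreover have "factors t {#two, subq, U#}"
    using factors_plus[OF factors_sub factors_gprime[OF prime]] U
    by (simp add: add_mset_commute)
  moreover have "unique_factors t"
    by (rule unique_factors_if_option_part[of sub]) (use t \<open>part sub t\<close> in \<open>auto simp: unique_factors_sub\<close>)
  ultimately show ?thesis using that[OF U prime \<open>U \<noteq> two\<close> neq] by auto
qed

lemma small_cases:
  assumes "small c"
  obtains "two \<in> opts c" | "opts c = {sub}"
  using assms by (auto simp: small_def)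

text \<open>Moving \<open>p\<close> to \<open>p'\<close> leads to \<open>p' + two\<close>, which
  must be \<open>two\<close>, \<open>sub\<close>, or revert to \<open>c\<close> by the move from
  \<open>two\<close> to \<open>0\<close>. These cases give the three possible options of
  \<open>p\<close>.\<close>

lemma small_two_optionE:
  assumes "small c" "two \<in> opts c"
  obtains p where "c = two + p" "gprime p" "factors c {#two, p#}"
    "p = two \<or> p \<notin> opts c \<and> p + two \<in> opts p \<and> opts p \<subseteq> {0, subq, c}"
proof -
  obtain p where p: "c = two + p" "p \<noteq> 0" using smallE[OF assms(1)] by blast
  have prime: "gprime p" using two_option_gprime p assms(2) by blast
  have np: "p \<in> opts c \<Longrightarrow> p = two"
    using assms(1) prime composite_sub by (auto simp: small_def composite_def)
  have "p \<noteq> two \<Longrightarrow> p + two \<in> opts p"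
    using plus_two_cases[of p] np p by (auto simp: add.commute)
  moreover have "p' \<in> {0, subq, c}" if "p' \<in> opts p" for p'
  proof -
    have "p' + two \<in> {two, sub} \<or> p' = c"
      using opts_plusI[OF that, of two] assms(1) p(1)
      by (auto simp: small_def opts_two add.commute[of p two])
    then show ?thesis by (auto simp: sub_eq)
  qed
  ultimately have "p = two \<or> p \<notin> opts c \<and> p + two \<in> opts p \<and> opts p \<subseteq> {0, subq, c}"
    using np by blast
  then show ?thesis using that[of p] p prime gprime_two by (auto simp: factors_def)
qed

lemma small_unique_factors: "small c \<Longrightarrow> unique_factors c"
  by (erule small_cases)
    (auto intro: unique_factors_gprime_option gprime_two elim: opts_sub_singletonE)

lemma small_size_factors:
  assumes "small c" "factors c F"
  shows "size F \<le> 3"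
proof -
  obtain E where "factors c E" "size E \<le> 3"
    using assms(1)
  proof (cases rule: small_cases)
    case 1
    obtain p where "factors c {#two, p#}" by (rule small_two_optionE[OF assms(1) 1])
    then show ?thesis using that[of "{#two, p#}"] by simp
  next
    case 2
    then show ?thesis using that by (elim opts_sub_singletonE) auto
  qed
  then show ?thesis using unique_factorsD[OF small_unique_factors] assms by blast
qed

text \<open>Small classes have at most three prime factors, and each nonzero summand contributes at
  least one. This is how options with too many summands are refuted later.\<close>

lemma small_not_four:
  assumes "small (a + b + c + d)" "a \<noteq> 0" "b \<noteq> 0" "c \<noteq> 0" "d \<noteq> 0"
  shows False
proof -
  obtain A B C D where F: "factors a A" "factors b B" "factors c C" "factors d D"
    using factors_exist by meson
  have "A \<noteq> {#}" "B \<noteq> {#}" "C \<noteq> {#}" "D \<noteq> {#}" using F assms(2-) by (auto simp: factors_def)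
  then have "1 \<le> size A" "1 \<le> size B" "1 \<le> size C" "1 \<le> size D"
    by (simp_all add: Suc_le_eq nonempty_has_size)
  moreover have "size (A + B + C + D) \<le> 3"
    using small_size_factors[OF assms(1)] factors_plus F by blast
  ultimately show False by simp
qed

lemma part_gprime_factor:
  assumes "unique_factors c" "factors c F" "part p c" "gprime p"
  shows "p \<in># F"
proof -
  obtain z where z: "c = z + p" using assms(3) by (auto simp: part_def)
  obtain Z where "factors z Z" using factors_exist by blast
  then have "factors c (Z + {#p#})" using z factors_plus factors_gprime assms(4) by blast
  then have "F = Z + {#p#}" using unique_factorsD assms by blast
  then show ?thesis by simp
qed

text \<open>A bad option \<open>q\<close> would be prime, so \<open>x = a + q\<close> with
  \<open>a\<close> prime too and \<open>two\<close> not dividing \<open>x\<close>. A move in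
  \<open>q\<close> produces the small option \<open>y + a\<close>, whose structure makes
  \<open>a\<close> absorb \<open>two\<close> or \<open>subq\<close>; then \<open>two + x\<close> or
  \<open>subq + x\<close> would be a small option of \<open>x\<close>, and both are
  contradictory.\<close>

lemma composite_bday_le_5:
  assumes "bday x \<le> 5" "composite x" "q \<in> opts x"
  shows "q = two \<or> small q"
proof (rule ccontr)
  assume contr: "\<not> (q = two \<or> small q)"
  have bq: "bday q \<le> 4" using bday_opts_less[OF assms(3)] assms(1) by simp
  have "q \<noteq> 0" using composite_option_nonzero assms by blast
  then have q0: "0 \<in> opts q" using bday_le_4_small[OF bq] contr by blast
  then have q: "gprime q" by (rule zero_option_gprime)
  obtain a where x: "x = a + q" and a0: "0 \<in> opts a"
    using compositeE[OF assms(2)] gprime_option_plus[OF _ q] assms(3) by (metis add.commute)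
  have a: "gprime a" using a0 by (rule zero_option_gprime)
  have nz: "a \<noteq> 0" "q \<noteq> 0" using a q by (auto simp: gprime_def)
  have ux: "unique_factors x" by (rule unique_factors_gprime_option[OF assms(3) q])
  have fx: "factors x {#a, q#}" using a q by (simp add: factors_def x)
  have "a \<noteq> two"
  proof
    assume "a = two"
    then have "bday q + 2 \<le> bday x"
      using plus_two_cases[of q] x bday_opts_less[OF assms(3)] bday_opts_less[of x q]
      by (auto simp: add.commute)
    then have "q = sub" using assms(1) bday_le_3D[of q] contr nz by auto
    then show False using contr small_sub by simp
  qed
  then have np: "\<not> part two x" using part_gprime_factor[OF ux fx _ gprime_two] contr by auto
  have small_opt: "small z" if "z \<in> opts x" "composite z" for z
    using composite_bday_le_4[OF that(2)] bday_opts_less[OF that(1)] assms(1) by simp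
  have "\<not> opts q \<subseteq> {0}" using opts_subset_0D contr nz by blast
  then obtain y where y: "y \<in> opts q" "y \<noteq> 0" by blast
  have y2: "y = two \<or> y = sub" using bday_opts_less[OF y(1)] bq bday_le_3D[of y] y(2) by auto
  then have py: "part two y" using part_two_sub by auto
  \<comment> \<open>The move to \<open>y\<close> cannot be reverted: as \<open>two\<close> divides
    \<open>y\<close>, the reverting equation would make \<open>two\<close> divide
    \<open>x\<close>.\<close>
  have "y + a \<in> opts x"
    using opts_plusI[OF y(1), of a] np part_plus_left[OF py] x by (metis add.commute)
  then have sya: "small (y + a)" using small_opt compositeI y nz by blast
  have a_small: "a \<noteq> sub" using a composite_sub by (auto simp: composite_def)
  from y2 show False
  proof
    assume [simp]: "y = two"
    have "a \<notin> opts (a + two)"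
      using sya \<open>a \<noteq> two\<close> a_small by (auto simp: small_def add.commute)
    then have "a + two \<in> opts a" using plus_two_cases[of a] by blast
    from opts_plusI[OF this, of q] have h: "two + x \<in> opts x"
      using np part_plus_left[OF part_plus(1)] x by (metis add.assoc add.commute)
    then have sh: "small (two + x)" using small_opt compositeI two_neq_0 assms(2)
      by (auto simp: composite_def)
    have "two \<notin> opts (two + x)"
      using two_not_option[of a q] nz x by (simp add: add.assoc)
    then have "opts (two + x) = {sub}" using sh small_cases by blast
    then have "sub \<in> opts (two + x)" by simp
    from opts_plusD[OF this] obtain x' where "x' \<in> opts x" "sub = two + x'"
      using np part_two_sub by (auto simp: opts_two)
    then have "subq \<in> opts x" by (metis add.commute add_left_cancel sub_eq)
    then show False using bday_opts_less bday_subq assms(1) by fastforce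
  next
    assume [simp]: "y = sub"
    have "two \<notin> opts (sub + a)"
      using two_not_option[of subq a] nz by (simp add: sub_eq add.commute)
    then have h: "opts (sub + a) = {sub}" using sya small_cases by auto
    obtain U where U: "sub + a = sub + U" "U \<noteq> subq" "opts U \<subseteq> {0, subq + U}" "U + subq \<in> opts U"
      using opts_sub_singletonE[OF h] by metis
    have aq: "a \<noteq> subq" "a + subq \<in> opts a" using U by auto
    have qsubq: "q \<noteq> subq" using bq bday_subq by auto
    from opts_plusI[OF aq(2), of q] have "subq + x \<in> opts x"
    proof (elim disjE bexE)
      fix b assume "a + subq + b = a + q"
      then have "q = subq + b" by (simp add: add.assoc)
      then show ?thesis using q qsubq unfolding gprime_def by (metis subq_neq(1) add_0_right)
    qed (simp add: x ac_simps)
    then have w: "small (subq + x)" using small_opt compositeI assms(2) by (auto simp: composite_def)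
    have "factors (subq + x) {#subq, a, q#}"
      using factors_plus[OF factors_gprime[OF gprime_subq] fx] by (simp add: add_mset_commute)
    from part_gprime_factor[OF small_unique_factors[OF w] this small_part_two[OF w] gprime_two]
    show False using \<open>a \<noteq> two\<close> contr by auto
  qed
qed

section \<open>Classes born by day 6\<close>

definition tame :: "gclass \<Rightarrow> bool" where
  "tame c \<longleftrightarrow> opts c \<noteq> {} \<and> (\<forall>q\<in>opts c. q = two \<or> small q)"

lemma tame_part_two: "tame c \<Longrightarrow> part two c"
  by (rule part_twoI) (auto simp: tame_def small_part_two)

lemma composite_tame: "composite c \<Longrightarrow> bday c \<le> 5 \<Longrightarrow> tame c"
  using composite_bday_le_5 by (auto simp: tame_def opts_empty_iff composite_def)

lemma part_twoE:
  assumes "part two c" "composite c"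
  obtains e where "c = two + e" "e \<noteq> 0"
proof -
  obtain e where "c = two + e" using assms(1) by (auto simp: part_def add.commute)
  then show ?thesis using that[of e] assms(2) gprime_two by (cases "e = 0") (auto simp: composite_def)
qed

lemma composite_plus: "composite c \<Longrightarrow> composite (c + d)" "composite c \<Longrightarrow> composite (d + c)"
proof -
  assume "composite c"
  then have "composite (c + d)"
    using compositeI[of c d] by (cases "d = 0") (auto simp: composite_def)
  then show "composite (c + d)" "composite (d + c)" by (simp_all add: add.commute)
qed

lemma plus_two_not_option_5:
  assumes "composite x" "bday x \<le> 5"
  shows "x + two \<notin> opts x"
proof
  assume *: "x + two \<in> opts x"
  then have "bday (x + two) \<le> 3"
    using plus_two_cases[of x] bday_opts_less[of "x + two" x] bday_opts_less[of x "x + two"] assms by auto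
  then have "x = 0 \<or> x + two = subq + two"
    using bday_le_3D[of "x + two"] two_neq_0 by (auto simp: sub_eq)
  then show False using assms gprime_subq by (auto simp: composite_def)
qed

text \<open>An option \<open>g + two\<close> would be born by day 4 and hence be small. It would
  contain \<open>two\<close> twice besides another factor, so its option set would be
  \<open>{sub}\<close>; but then \<open>two\<close> occurs only once.\<close>

lemma plus_two_not_option_6:
  assumes "composite g" "bday g \<le> 6" "part two g"
  shows "g + two \<notin> opts g"
proof
  assume "g + two \<in> opts g"
  then have "bday (g + two) \<le> 4"
    using plus_two_cases[of g] bday_opts_less[of "g + two" g] bday_opts_less[of g "g + two"] assms by auto
  then have h: "small (g + two)" using composite_bday_le_4 composite_plus assms(1) by blast
  obtain e where e: "g = two + e" "e \<noteq> 0" using part_twoE assms by blast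
  have "g + two = two + two + e" by (simp add: e ac_simps)
  then have "two \<notin> opts (g + two)" using two_not_option[OF two_neq_0 e(2)] by simp
  then have "opts (g + two) = {sub}" using h small_cases by blast
  then obtain U where U: "U \<noteq> two" "factors (g + two) {#two, subq, U#}" by (rule opts_sub_singletonE)
  obtain R where "factors e R" using factors_exist by blast
  then have "factors (g + two) ({#two#} + R + {#two#})"
    using factors_plus factors_gprime[OF gprime_two] e by metis
  then have "{#two#} + R + {#two#} = {#two, subq, U#}"
    using unique_factorsD[OF small_unique_factors[OF h]] U by blast
  then have "count ({#two#} + R + {#two#}) two = count {#two, subq, U#} two" by simp
  then show False using U by simp
qed

text \<open>The situation left once classes with an option \<open>0\<close> or a prime option are
  settled; uniqueness for the options is the induction hypothesis.\<close>

locale day6 =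
  fixes g :: gclass
  assumes bday_g: "bday g \<le> 6"
    and g_nonzero: "g \<noteq> 0"
    and option_composite: "\<And>x. x \<in> opts g \<Longrightarrow> composite x"
    and option_unique: "\<And>x. x \<in> opts g \<Longrightarrow> unique_factors x"
begin

lemma option_bday: "x \<in> opts g \<Longrightarrow> bday x \<le> 5"
  using bday_opts_less bday_g by fastforce

lemma option_tame: "x \<in> opts g \<Longrightarrow> tame x"
  using composite_tame option_bday option_composite by blast

lemma part_two_g: "part two g"
  by (rule part_twoI[OF g_nonzero tame_part_two[OF option_tame]])

lemma composite_g: "composite g"
proof -
  obtain z where z: "g = z + two" using part_two_g by (auto simp: part_def)
  have "z \<noteq> 0"
  proof
    assume "z = 0"
    then have "0 \<in> opts g" using z opts_two by simp
    then show False using option_composite by (auto simp: composite_def)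
  qed
  then show ?thesis using compositeI two_neq_0 z by blast
qed

lemma plus_two: "g + two \<notin> opts g"
  by (rule plus_two_not_option_6[OF composite_g bday_g part_two_g])

lemma option_twoE:
  assumes "x \<in> opts g"
  obtains e where "x = two + e" "e \<noteq> 0"
  using part_twoE tame_part_two option_tame option_composite assms by blast

lemma g_twoE: obtains e where "g = two + e" "e \<noteq> 0"
  using part_twoE part_two_g composite_g by blast

lemma two_not_option_plus:
  assumes "p \<noteq> 0"
  shows "two \<notin> opts (g + p)"
proof -
  obtain e where "g = two + e" "e \<noteq> 0" by (rule g_twoE)
  then show ?thesis using two_not_option assms by simp
qed

lemma option_plus_opts:
  assumes "x \<in> opts g" "p \<noteq> 0" "small (x + p)"
  shows "opts (x + p) = {sub}"
proof -
  obtain e where "x = two + e" "e \<noteq> 0" using option_twoE assms by blast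
  then show ?thesis using two_not_option assms small_cases by metis
qed

lemma option_plus_small:
  assumes "g + p \<in> opts g" "p \<noteq> 0" "o' \<in> opts (g + p)"
  shows "small o'"
  using option_tame[OF assms(1)] assms(3) two_not_option_plus[OF assms(2)] by (auto simp: tame_def)

text \<open>This is the side condition for absorbing \<open>p\<close>. If \<open>g + p\<close> were
  an option of \<open>g\<close>, all its options would be small, and each possible origin of such an
  option conflicts with what is known of small classes or with decreasing birthdays.\<close>

lemma plus_prime_not_option:
  assumes y: "small y" "two \<in> opts y" "y = two + p" and p: "p \<noteq> two"
  shows "g + p \<notin> opts g"
proof
  assume h: "g + p \<in> opts g"
  obtain p' where "y = two + p'" "gprime p'" "p' = two \<or> p' \<notin> opts y \<and> p' + two \<in> opts p' \<and> opts p' \<subseteq> {0, subq, y}"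
    by (rule small_two_optionE[OF y(1,2)])
  then have pp: "gprime p" "p + two \<in> opts p" "opts p \<subseteq> {0, subq, y}" using y(3) p by auto
  have p0: "p \<noteq> 0" using pp(1) by (rule gprime_nonzero)
  have "opts (g + p) \<noteq> {}" using h g_nonzero by (simp add: opts_empty_iff)
  then obtain q where q: "q \<in> opts (g + p)" by blast
  have sq: "small q" by (rule option_plus_small[OF h p0 q])
  obtain e where e: "g = two + e" "e \<noteq> 0" by (rule g_twoE)
  from opts_plusD[OF q] show False
  proof (elim disjE bexE)
    fix x assume x: "x \<in> opts g" "q = x + p"
    then have "opts q = {sub}" using option_plus_opts p0 sq by blast
    then obtain U where U: "gprime U" "U \<noteq> two" "U \<noteq> subq" "U + two \<notin> opts U" "factors q {#two, subq, U#}"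
      by (rule opts_sub_singletonE)
    have "p \<in># {#two, subq, U#}"
      using part_gprime_factor[OF small_unique_factors[OF sq] U(5) _ pp(1)] x(2) part_plus(1) by blast
    then consider "p = subq" | "p = U" using p by auto
    then show False
    proof cases
      case 1
      have "q = two + subq + U" using U(5) by (simp add: factors_def ac_simps)
      then have "x + subq = (two + U) + subq" using x 1 by (simp add: ac_simps)
      then have xU: "x = U + two" by (simp add: add.commute)
      have "U \<notin> opts x"
        using option_tame[OF x(1)] U small_not_gprime by (auto simp: tame_def)
      then show ?thesis using plus_two_cases[of U] U(4) xU by auto
    next
      case 2
      then show ?thesis using pp U by blast
    qed
  next
    fix b assume b: "b \<in> opts p" "q = g + b"
    then consider "b = 0" | "b = subq" | "b = y" using pp by blast
    then show False
    proof cases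
      case 1
      then show ?thesis using b q h bday_opts_less[of g "g + p"] bday_opts_less[of "g + p" g] by simp
    next
      case 3
      then have "small (two + e + two + p)" using sq b e y(3) by (simp add: ac_simps)
      then show ?thesis using small_not_four e(2) two_neq_0 p0 by blast
    next
      case 2
      \<comment> \<open>Here \<open>sub\<close> is an option of \<open>q = g + subq\<close>. Tracing
        \<open>sub\<close> back by one move makes an option of \<open>g\<close> equal to
        \<open>two\<close>, or \<open>g\<close> itself equal to \<open>0\<close>, \<open>two\<close>
        or \<open>sub\<close>.\<close>
      have "two \<notin> opts q" using b 2 two_not_option_plus[of subq] by simp
      then have "sub \<in> opts (g + subq)" using small_cases[OF sq] b 2 by auto
      from opts_plusD[OF this] show ?thesis
      proof (elim disjE bexE)
        fix x assume x: "x \<in> opts g" "sub = x + subq"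
        then have "x = two" by (metis add.commute add_right_cancel sub_eq)
        then show False using option_composite[OF x(1)] gprime_two by (simp add: composite_def)
      next
        fix b' assume b': "b' \<in> opts subq" "sub = g + b'"
        obtain p2 where "sub = two + p2" "p2 = two \<or> opts p2 \<subseteq> {0, subq, sub}"
          by (rule small_two_optionE[OF small_sub]) (auto simp: opts_sub)
        then have "opts subq \<subseteq> {0, subq, sub}"
          by (metis add.commute add_left_cancel sub_eq subq_neq(2))
        then have "sub = g \<or> sub = g + subq \<or> sub = g + sub" using b' by auto
        moreover have "sub \<noteq> g"
          using option_composite[of two] gprime_two by (auto simp: composite_def opts_sub)
        moreover have "sub \<noteq> g + subq"
        proof
          assume "sub = g + subq"
          then have "g = two" by (metis add.commute add_right_cancel sub_eq)
          then show False using composite_g gprime_two by (simp add: composite_def)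
        qed
        ultimately show False using g_nonzero by auto
      qed
    qed
  qed
qed

text \<open>The same side condition for the third factor \<open>U\<close> of a class with option set
  \<open>{sub}\<close>. An option \<open>x\<close> of \<open>g\<close> with \<open>x + U\<close>
  small would have to be \<open>two + subq\<close>, which \<open>no2\<close> excludes.\<close>

lemma plus_factor_not_option:
  assumes no2: "\<And>r. gprime r \<Longrightarrow> two + r \<notin> opts g"
    and U: "gprime U" "U \<noteq> two" "U \<noteq> subq" "opts U \<subseteq> {0, subq + U}"
  shows "g + U \<notin> opts g"
proof
  assume h: "g + U \<in> opts g"
  have U0: "U \<noteq> 0" using U(1) by (rule gprime_nonzero)
  have "opts (g + U) \<noteq> {}" using g_nonzero by (simp add: opts_empty_iff)
  then obtain q where q: "q \<in> opts (g + U)" by blast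
  have sq: "small q" by (rule option_plus_small[OF h U0 q])
  obtain e where e: "g = two + e" "e \<noteq> 0" by (rule g_twoE)
  from opts_plusD[OF q] show False
  proof (elim disjE bexE)
    fix x assume x: "x \<in> opts g" "q = x + U"
    then have "opts q = {sub}" using option_plus_opts U0 sq by blast
    then obtain V where V: "factors q {#two, subq, V#}" by (rule opts_sub_singletonE)
    have "U \<in># {#two, subq, V#}"
      using part_gprime_factor[OF small_unique_factors[OF sq] V _ U(1)] x(2) part_plus(1) by blast
    then have "V = U" using U by auto
    then have "x + U = (two + subq) + U" using V x by (simp add: factors_def ac_simps)
    then have "x = two + subq" by (simp only: add_right_cancel)
    then show False using no2[OF gprime_subq] x by simp
  next
    fix b assume b: "b \<in> opts U" "q = g + b"
    then consider "b = 0" | "b = subq + U" using U by blast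
    then show False
    proof cases
      case 1
      then show ?thesis using b q h bday_opts_less[of g "g + U"] bday_opts_less[of "g + U" g] by simp
    next
      case 2
      then have "small (two + e + subq + U)" using sq b e by (simp add: ac_simps)
      then show ?thesis using small_not_four e(2) two_neq_0 U0 subq_neq(1) by blast
    qed
  qed
qed

text \<open>The prime \<open>r\<close> is no option of the tame class \<open>two + r\<close> unless
  \<open>r = two\<close>, so otherwise \<open>r\<close> absorbs \<open>two\<close>.\<close>

lemma unique_factors_2:
  assumes x: "two + r \<in> opts g" and r: "gprime r"
  shows "unique_factors g"
proof (rule unique_factors_chain[OF x option_unique[OF x]])
  show "factors (two + r) (mset [two, r])" using r gprime_two by (simp add: factors_def)
  have r2: "r + two \<in> opts r" if "r \<noteq> two"
    using plus_two_cases[of r] option_tame[OF x] that small_not_gprime r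
    by (auto simp: tame_def add.commute)
  fix F assume F: "factors g F"
  have rF: "two \<in># F - {#r#}" if "r \<in># F" "r \<noteq> two"
    by (rule absorbed_factor[OF F that(1) r2[OF that(2)] two_neq_0 plus_two])
  consider "two \<notin># F" | "two \<in># F" "r \<notin># F - {#two#}" | "two \<in># F" "r \<in># F - {#two#}" by blast
  then show "\<exists>k. F \<inter># mset [two, r] = mset (take k [two, r])"
  proof cases
    case 1
    then have "r \<notin># F" using rF by (cases "r = two") (auto dest: in_diffD)
    then show ?thesis using 1 by (intro exI[of _ 0]) simp
  next
    case 2
    then show ?thesis by (intro exI[of _ 1]) (simp add: inter_add_right2)
  next
    case 3
    then show ?thesis by (intro exI[of _ 2]) (simp add: inter_add_right2)
  qed
qed

text \<open>\<open>v\<close> absorbs \<open>p\<close>, and \<open>p\<close> absorbs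
  \<open>two\<close>.\<close>

lemma unique_factors_3:
  assumes x: "two + p + v \<in> opts g"
    and y: "small (two + p)" "two \<in> opts (two + p)" and p: "gprime p" "p \<noteq> two"
    and v: "gprime v" "v \<noteq> two" "v \<noteq> p" "v + p \<in> opts v"
  shows "unique_factors g"
proof (rule unique_factors_chain[OF x option_unique[OF x]])
  show "factors (two + p + v) (mset [two, p, v])"
    using gprime_two p v by (simp add: factors_def ac_simps)
  obtain p' where "two + p = two + p'" "p' = two \<or> p' + two \<in> opts p'"
    by (rule small_two_optionE[OF y]) blast
  then have p2: "p + two \<in> opts p" using p by auto
  fix F assume F: "factors g F"
  have pF: "two \<in># F" if "p \<in># F"
    using absorbed_factor[OF F that p2 two_neq_0 plus_two] by (rule in_diffD)
  have vF: "p \<in># F" if "v \<in># F"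
    using absorbed_factor[OF F that v(4) gprime_nonzero[OF p(1)] plus_prime_not_option[OF y refl p(2)]]
    by (rule in_diffD)
  have in_diff: "a \<in># A - B \<longleftrightarrow> a \<in># A" if "a \<notin># B" for a :: gclass and A B
    using that by (simp add: in_diff_count not_in_iff)
  consider "two \<notin># F" | "two \<in># F" "p \<notin># F" | "p \<in># F" "v \<notin># F" | "v \<in># F" by blast
  then show "\<exists>k. F \<inter># mset [two, p, v] = mset (take k [two, p, v])"
  proof cases
    case 1
    then show ?thesis using pF vF by (intro exI[of _ 0]) auto
  next
    case 2
    then show ?thesis using vF p v
      by (intro exI[of _ 1]) (auto simp: inter_add_right2 in_diff)
  next
    case 3
    then show ?thesis using pF p v
      by (intro exI[of _ 2]) (auto simp: inter_add_right2 in_diff dest: in_diffD)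
  next
    case 4
    then show ?thesis using pF vF p v
      by (intro exI[of _ 3]) (auto simp: inter_add_right2 in_diff)
  qed
qed

text \<open>Absorption by \<open>v\<close> yields only one copy of \<open>two\<close>. The second
  comes from running the absorption argument with the composite \<open>two + v\<close> in place of a
  prime.\<close>

lemma unique_factors_two_two:
  assumes x: "two + two + v \<in> opts g"
    and v: "gprime v" "v \<noteq> two" "v + two \<in> opts v" and k: "two + two + v \<in> opts (two + v)"
  shows "unique_factors g"
proof (rule unique_factors_chain[OF x option_unique[OF x]])
  show "factors (two + two + v) (mset [two, two, v])"
    using gprime_two v by (simp add: factors_def ac_simps)
  fix F assume F: "factors g F"
  have vF: "two \<in># F - {#two#}" if "v \<in># F"
  proof -
    have "two \<in># F - {#v#}" by (rule absorbed_factor[OF F that v(3) two_neq_0 plus_two])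
    then obtain D where "F - {#v#} = add_mset two D" by (rule mset_add)
    then have D: "F = add_mset v (add_mset two D)" using insert_DiffM[OF that] by simp
    have sum: "g = (two + v) + \<Sum>\<^sub># D" using F D by (simp add: factors_def ac_simps)
    from opts_plusI[OF k, of "\<Sum>\<^sub># D"] have "two \<in># D"
    proof (elim disjE bexE)
      assume "two + two + v + \<Sum>\<^sub># D \<in> opts (two + v + \<Sum>\<^sub># D)"
      moreover have "two + two + v + \<Sum>\<^sub># D = g + two" by (simp add: sum ac_simps)
      ultimately show ?thesis using plus_two sum by simp
    next
      fix d assume d: "d \<in> opts (\<Sum>\<^sub># D)" "two + two + v + d = two + v + \<Sum>\<^sub># D"
      obtain q q' where q: "q \<in># D" "d = q' + \<Sum>\<^sub># (D - {#q#})" using opts_sum_msetD[OF d(1)] by blast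
      have "\<Sum>\<^sub># D = q + \<Sum>\<^sub># (D - {#q#})" using q(1) by (metis insert_DiffM sum_mset.add_mset)
      moreover have "(two + v) + (two + d) = (two + v) + \<Sum>\<^sub># D" using d(2) by (simp add: ac_simps)
      ultimately have "(two + q') + \<Sum>\<^sub># (D - {#q#}) = q + \<Sum>\<^sub># (D - {#q#})"
        using q(2) by (simp add: add.assoc)
      then have "q = two + q'" by (metis add_right_cancel)
      moreover have "gprime q" using F D q(1) by (auto simp: factors_def)
      ultimately have "q = two" using two_neq_0 by (auto simp: gprime_def)
      then show ?thesis using q by simp
    qed
    then show ?thesis using D v(2) by simp
  qed
  have in_diff: "a \<in># A - B \<longleftrightarrow> a \<in># A" if "a \<notin># B" for a :: gclass and A B
    using that by (simp add: in_diff_count not_in_iff)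
  consider "two \<notin># F" | "two \<in># F" "two \<notin># F - {#two#}" | "two \<in># F - {#two#}" "v \<notin># F"
    | "v \<in># F" by blast
  then show "\<exists>k. F \<inter># mset [two, two, v] = mset (take k [two, two, v])"
  proof cases
    case 1
    then show ?thesis using vF by (intro exI[of _ 0]) (auto dest: in_diffD)
  next
    case 2
    then show ?thesis using vF v by (intro exI[of _ 1]) (auto simp: inter_add_right2 in_diff)
  next
    case 3
    then show ?thesis using in_diffD[OF 3(1)] v
      by (intro exI[of _ 2]) (auto simp: inter_add_right2 in_diff dest: in_diffD)
  next
    case 4
    then show ?thesis using vF in_diffD[OF vF] v
      by (intro exI[of _ 3]) (auto simp: inter_add_right2 in_diff)
  qed
qed

end

text \<open>\<open>p\<close> has the option \<open>y\<close>, so \<open>y + p\<close> could move to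
  \<open>y + y\<close>, which is a sum of four nonzero classes; reverting this move would need
  \<open>p\<close> as an option of \<open>y\<close>.\<close>

lemma no_double_factor:
  assumes y: "y = two + p" "p + two \<in> opts p" "p \<notin> opts y" "p \<noteq> 0"
    and x: "\<And>z. z \<in> opts (y + p) \<Longrightarrow> small z"
  shows False
proof -
  have "y \<in> opts p" using y by (simp add: add.commute)
  from opts_plusI[OF this, of y] show False
  proof (elim disjE bexE)
    assume "y + y \<in> opts (p + y)"
    then have "small (two + p + two + p)" using x[of "y + y"] y(1) by (simp add: ac_simps)
    then show False using small_not_four two_neq_0 y(4) by blast
  next
    fix b assume "b \<in> opts y" "y + b = p + y"
    then show False using y(3) by (simp add: add.commute[of p])
  qed
qed

context day6
begin

text \<open>The longest chain: \<open>v\<close> absorbs \<open>U\<close>, \<open>U\<close> absorbs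
  \<open>subq\<close>, and \<open>subq\<close> absorbs \<open>two\<close>.\<close>

lemma unique_factors_chain4:
  assumes x: "two + subq + U + v \<in> opts g"
    and no2: "\<And>r. gprime r \<Longrightarrow> two + r \<notin> opts g"
    and U: "gprime U" "U \<noteq> two" "U \<noteq> subq" "opts U \<subseteq> {0, subq + U}" "U + subq \<in> opts U"
    and v: "gprime v" "v + U \<in> opts v"
  shows "unique_factors g"
proof (rule unique_factors_chain[OF x option_unique[OF x]])
  let ?L = "[two, subq, U, v]"
  show "factors (two + subq + U + v) (mset ?L)"
    using gprime_two gprime_subq U v by (simp add: factors_def ac_simps)
  have U0: "U \<noteq> 0" using U(1) by (rule gprime_nonzero)
  have v2: "v \<noteq> two" using v(2) U0 by (auto simp: opts_two)
  have vU: "v \<noteq> U"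
  proof
    assume "v = U"
    then have "U + U = 0 \<or> U + U = subq + U" using v(2) U(4) by auto
    then show False using U0 U(3) by simp
  qed
  have vq: "v \<noteq> subq"
  proof
    assume "v = subq"
    obtain p where "sub = two + p" "p = two \<or> opts p \<subseteq> {0, subq, sub}"
      by (rule small_two_optionE[OF small_sub]) (auto simp: opts_sub)
    then have "opts subq \<subseteq> {0, subq, sub}"
      by (metis add.commute add_left_cancel sub_eq subq_neq(2))
    then have "subq + U \<in> {0, subq, subq + two}" using v(2) \<open>v = subq\<close> sub_eq by auto
    then show False using U0 U(2) by auto
  qed
  fix F assume F: "factors g F"
  have 1: "two \<in># F" if "subq \<in># F"
    using absorbed_factor[OF F that sub_option_subq[unfolded sub_eq] two_neq_0 plus_two]
    by (rule in_diffD)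
  have 2: "subq \<in># F" if "U \<in># F"
  proof -
    have "two \<in> opts sub" "sub = two + subq" by (simp add: opts_sub) (simp add: sub_eq add.commute)
    from absorbed_factor[OF F that U(5) subq_neq(1) plus_prime_not_option[OF small_sub this subq_neq(2)]]
    show ?thesis by (rule in_diffD)
  qed
  have 3: "U \<in># F" if "v \<in># F"
    using absorbed_factor[OF F that v(2) U0 plus_factor_not_option[OF no2 U(1-4)]]
    by (auto dest: in_diffD)
  have in_diff: "a \<in># A - B \<longleftrightarrow> a \<in># A" if "a \<notin># B" for a :: gclass and A B
    using that by (simp add: in_diff_count not_in_iff)
  note neq = U(2,3) v2 vU vq
  consider "two \<notin># F" | "two \<in># F" "subq \<notin># F" | "subq \<in># F" "U \<notin># F" | "U \<in># F" "v \<notin># F"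
    | "v \<in># F" by blast
  then show "\<exists>k. F \<inter># mset ?L = mset (take k ?L)"
  proof cases
    case a: 1
    then show ?thesis using 1 2 3 by (intro exI[of _ 0]) auto
  next
    case a: 2
    then show ?thesis using 2 3 neq
      by (intro exI[of _ 1]) (auto simp: inter_add_right2 in_diff dest: in_diffD)
  next
    case a: 3
    then show ?thesis using 1 3 neq
      by (intro exI[of _ 2]) (auto simp: inter_add_right2 in_diff dest: in_diffD)
  next
    case a: 4
    then show ?thesis using 1 2 neq
      by (intro exI[of _ 3]) (auto simp: inter_add_right2 in_diff dest: in_diffD)
  next
    case a: 5
    then show ?thesis using 1 2 3 neq
      by (intro exI[of _ 4]) (auto simp: inter_add_right2 in_diff dest: in_diffD)
  qed
qed

text \<open>The last alternative is the only option type whose factorization is not totally ordered by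
  absorption of factors.\<close>

lemma option_cases:
  assumes x: "x \<in> opts g" and no2: "\<And>r. gprime r \<Longrightarrow> two + r \<notin> opts g"
  shows "unique_factors g \<or> x = two + sub"
proof -
  have ux: "unique_factors x" and cx: "composite x" and tx: "tame x" and bx: "bday x \<le> 5"
    using option_unique option_composite option_tame option_bday x by auto
  have p2: "part two x" using tx by (rule tame_part_two)
  have "two \<notin> opts x"
  proof
    assume "two \<in> opts x"
    moreover obtain e where "x = two + e" "e \<noteq> 0" using option_twoE[OF x] by blast
    ultimately show False using no2[of e] two_option_gprime[of e] x by blast
  qed
  then have small_opt: "small z" if "z \<in> opts x" for z
    using tx that by (auto simp: tame_def)
  obtain X where X: "factors x X" using factors_exist by blast
  have prime_X: "gprime r" if "r \<in># X" for r using X that by (simp add: factors_def)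
  have twoX: "two \<in># X" by (rule part_gprime_factor[OF ux X p2 gprime_two])
  have not2: "X \<noteq> {#a, b#}" for a b
  proof
    assume "X = {#a, b#}"
    then have "x = a + b" "a = two \<and> gprime b \<or> b = two \<and> gprime a"
      using X twoX by (auto simp: factors_def)
    then show False using no2[of a] no2[of b] x by (auto simp: add.commute[of a two])
  qed
  have not1: "X \<noteq> {#a#}" for a
    using X cx by (auto simp: factors_def composite_def)
  \<comment> \<open>One factor is impossible since \<open>x\<close> is composite; two factors would
    be \<open>two\<close> and another prime, against \<open>no2\<close>.\<close>
  have size_X: "3 \<le> size X"
  proof -
    obtain R where R: "X = add_mset two R" using twoX by (rule mset_add)
    then have "R \<noteq> {#}" "size R \<noteq> 1"
      using not1 not2 size_1_singleton_mset[of R] by auto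
    then have "2 \<le> size R" using nonempty_has_size[of R] by linarith
    then show ?thesis by (simp add: R)
  qed
  consider (two) y where "y \<in> opts x" "two \<in> opts y" | (sub) "\<And>y. y \<in> opts x \<Longrightarrow> opts y = {sub}"
    using small_opt small_cases by metis
  then show ?thesis
  proof cases
    case (two y)
    have sy: "small y" using small_opt two(1) by blast
    obtain p where p: "y = two + p" "gprime p" "factors y {#two, p#}"
      "p = two \<or> p \<notin> opts y \<and> p + two \<in> opts p \<and> opts p \<subseteq> {0, subq, y}"
      by (rule small_two_optionE[OF sy two(2)])
    \<comment> \<open>Only one factor of \<open>x\<close> can lie outside the two factors of
      \<open>y\<close>, and \<open>x\<close> has at least three; hence
      \<open>x = y + v\<close>.\<close>
    obtain v where v: "v \<in># X" "X - {#v#} \<subseteq># {#two, p#}"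
      using factors_option[OF two(1) small_unique_factors[OF sy] p(3) X] by blast
    have "X - {#v#} = {#two, p#}"
      using v size_X size_Diff_singleton[OF v(1)] mset_subset_size[of "X - {#v#}" "{#two, p#}"]
      by (auto simp: subset_mset.le_less)
    then have Xv: "X = add_mset v {#two, p#}" using v(1) by (metis insert_DiffM)
    then have xv: "x = y + v" using X p(1) by (simp add: factors_def ac_simps)
    have pv: "gprime v" using prime_X v(1) by blast
    have p0: "p \<noteq> 0" and v0: "v \<noteq> 0" using p(2) pv gprime_nonzero by auto
    \<comment> \<open>The move of \<open>y\<close> to \<open>two\<close> survives in
      \<open>x\<close>, or \<open>v\<close> reverts it by moving to \<open>v + p\<close>.\<close>
    from opts_plusI[OF two(2), of v] have "two + v \<in> opts x \<or> v + p \<in> opts v"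
      using xv p(1) by (auto simp: add.assoc) (metis add.commute)
    then show ?thesis
    proof
      assume z: "two + v \<in> opts x"
      then have sz: "small (two + v)" by (rule small_opt)
      \<comment> \<open>Otherwise \<open>v\<close> has the option \<open>v + two\<close>, which
        would make \<open>x + two\<close> an option of \<open>x\<close>.\<close>
      have "p = two \<or> v = two"
      proof (rule ccontr)
        assume neq: "\<not> (p = two \<or> v = two)"
        have "v \<notin> opts (two + v)"
          using neq sz pv composite_sub by (auto simp: small_def composite_def)
        then have "v + two \<in> opts v" using plus_two_cases[of v] by (auto simp: add.commute)
        from opts_plusI[OF this, of y] show False
        proof (elim disjE bexE)
          assume "v + two + y \<in> opts (v + y)"
          then have "x + two \<in> opts x" using xv by (simp add: ac_simps)
          then show False using plus_two_not_option_5[OF cx bx] by blast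
        next
          fix b assume b: "b \<in> opts y" "v + two + b = v + y"
          then have "b = p" using p(1) by (simp add: add.assoc)
          then show False using b p(4) neq by blast
        qed
      qed
      then obtain w where w: "x = two + w + two" "small (two + w)" "two + w \<in> opts x"
      proof
        assume "p = two"
        then show thesis using that[of v] xv p(1) sz z by (simp add: ac_simps)
      next
        assume "v = two"
        then show thesis using that[of p] xv p(1) sy two(1) by (simp add: ac_simps)
      qed
      \<comment> \<open>\<open>x\<close> is the sum of its option \<open>two + w\<close> and
        \<open>two\<close>, hence born at least two days after that option.\<close>
      have "bday (two + w) \<le> 3"
        using plus_two_cases[of "two + w"] bday_opts_less[OF w(3)] bday_opts_less[of x "two + w"] bx w(1)
        by auto
      then have "two + w = sub" using bday_le_3D small_neq[OF w(2)] by blast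
      then show ?thesis using w(1) by (simp add: add.commute)
    next
      assume vp: "v + p \<in> opts v"
      have v2: "v \<noteq> two" using vp p0 v0 by (auto simp: opts_two)
      show ?thesis
      proof (cases "p = two")
        case False
        have "v \<noteq> p"
          using no_double_factor[of y p] p False small_opt p0 xv by auto
        then have "unique_factors g"
          using unique_factors_3[of p v] x xv p sy two(2) False pv v2 vp by simp
        then show ?thesis ..
      next
        case [simp]: True
        have xv': "x = two + two + v" using xv p(1) by simp
        show ?thesis
        proof (cases "two + v \<in> opts x")
          case True
          then have "bday (two + v) \<le> 3"
            using plus_two_cases[of "two + v"] bday_opts_less[of "two + v" x] bday_opts_less[of x "two + v"] bx
            by (auto simp: xv' ac_simps)
          then have "two + v = sub" using bday_le_3D[of "two + v"] v0 small_opt[OF True] by auto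
          then show ?thesis using xv' by (simp add: add.assoc)
        next
          case False
          \<comment> \<open>The other side of the dichotomy supplies just the option needed to
            absorb the second copy of \<open>two\<close>.\<close>
          then have "x \<in> opts (two + v)"
            using plus_two_cases[of "two + v"] by (auto simp: xv' ac_simps)
          then have "unique_factors g"
            using unique_factors_two_two[of v] x xv' pv v2 vp by simp
          then show ?thesis ..
        qed
      qed
    qed
  next
    case sub
    have "opts x \<noteq> {}" using cx by (simp add: opts_empty_iff composite_def)
    then obtain y where y: "y \<in> opts x" by blast
    obtain U where U: "y = sub + U" "gprime U" "U \<noteq> two" "U \<noteq> subq" "U + two \<notin> opts U"
      "opts U \<subseteq> {0, subq + U}" "U + subq \<in> opts U" "factors y {#two, subq, U#}" "unique_factors y"
      by (rule opts_sub_singletonE[OF sub[OF y]])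
    have U0: "U \<noteq> 0" using U(2) by (rule gprime_nonzero)
    have "part sub z" if "z \<in> opts x" for z
      using opts_sub_singletonE[OF sub[OF that]] part_plus(2) by metis
    then have "part sub x"
      using p2 cx by (intro part_if_opts[of x sub]) (auto simp: opts_sub composite_def)
    then obtain c where c: "x = c + sub" by (auto simp: part_def)
    obtain C where "factors c C" using factors_exist by blast
    then have XC: "X = C + {#two, subq#}"
      using factors_plus[OF _ factors_sub] c unique_factorsD[OF ux X] by blast
    obtain v where v: "v \<in># X" "X - {#v#} \<subseteq># {#two, subq, U#}"
      using factors_option[OF y U(9,8) X] by blast
    have C: "size C = 1 \<or> size C = 2"
      using XC size_X size_mset_mono[OF v(2)] size_Diff_singleton[OF v(1)] by simp linarith
    have sub_part: "\<exists>V. factors z {#two, subq, V#} \<and> z = sub + V" if "z \<in> opts x" for z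
      using opts_sub_singletonE[OF sub[OF that]] by metis
    have sub_unique: "unique_factors z" if "z \<in> opts x" for z
      using opts_sub_singletonE[OF sub[OF that]] by metis
    from C show ?thesis
    proof
      assume "size C = 1"
      then obtain w where w: "C = {#w#}" using size_1_singleton_mset by blast
      have xw: "x = sub + w" using \<open>factors c C\<close> w c by (simp add: factors_def add.commute)
      have pw: "gprime w" using XC w prime_X by simp
      \<comment> \<open>Every option of \<open>x\<close> has three prime factors here,
        \<open>two + w\<close> only two.\<close>
      have "two + w \<notin> opts x"
      proof
        assume "two + w \<in> opts x"
        then obtain V where "factors (two + w) {#two, subq, V#}" "unique_factors (two + w)"
          using sub_part sub_unique by blast
        moreover have "factors (two + w) {#two, w#}" using gprime_two pw by (simp add: factors_def)
        ultimately have "{#two, subq, V#} = {#two, w#}" using unique_factorsD by blast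
        then have "size {#two, subq, V#} = size {#two, w#}" by simp
        then show False by simp
      qed
      then obtain w' where "w' \<in> opts w" "two + w' = sub + w"
        using opts_plusI[of two sub w] xw by (auto simp: opts_sub)
      moreover have "two + (w + subq) = sub + w" by (simp add: sub_eq ac_simps)
      ultimately have ws: "w + subq \<in> opts w" by (metis add_left_cancel)
      have "w \<noteq> subq"
        using no_double_factor[of sub subq] sub_option_subq small_opt xw
        by (auto simp: sub_eq add.commute opts_sub simp flip: sub_eq)
      moreover have "w \<noteq> two" using ws gprime_nonzero[OF pw] by (auto simp: opts_two)
      ultimately have "unique_factors g"
        using unique_factors_3[of subq w] x xw small_sub pw ws gprime_subq
        by (simp add: opts_sub add.commute[of two] flip: sub_eq)
      then show ?thesis ..
    next
      assume "size C = 2"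
      then have "X - {#v#} = {#two, subq, U#}"
        using XC v size_Diff_singleton[OF v(1)] mset_subset_size[of "X - {#v#}" "{#two, subq, U#}"]
        by (auto simp: subset_mset.le_less)
      then have Xv: "X = add_mset v {#two, subq, U#}" using v(1) by (metis insert_DiffM)
      then have xv: "x = two + subq + U + v" using X by (simp add: factors_def ac_simps)
      have pv: "gprime v" using v(1) prime_X by blast
      have v0: "v \<noteq> 0" using pv by (rule gprime_nonzero)
      have xy: "x = y + v" using xv U(1) by (simp add: sub_eq ac_simps)
      \<comment> \<open>As an option, \<open>sub + v\<close> would make \<open>v\<close> absorb
        \<open>subq\<close>. Moving \<open>v\<close> accordingly in \<open>x\<close> gives a small
        class with too many factors, or a reversal with \<open>U = subq\<close>.\<close>
      have "sub + v \<notin> opts x"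
      proof
        assume z: "sub + v \<in> opts x"
        obtain V where V: "sub + v = sub + V" "V + subq \<in> opts V"
          using opts_sub_singletonE[OF sub[OF z]] by metis
        then have "v + subq \<in> opts v" by simp
        from opts_plusI[OF this, of y] show False
        proof (elim disjE bexE)
          assume "v + subq + y \<in> opts (v + y)"
          then have "small (v + subq + y)" using small_opt xy by (simp add: add.commute)
          moreover have "v + subq + y = v + subq + sub + U" using U(1) by (simp add: ac_simps)
          ultimately show False
            using small_not_four[of v subq sub U] v0 subq_neq(1) sub_neq_0 U0 by simp
        next
          fix b assume b: "b \<in> opts y" "v + subq + b = v + y"
          then have "subq + sub = sub + U" using sub[OF y] U(1) by (simp add: add.assoc)
          then show False using U(4) by (simp add: add.commute)
        qed
      qed
      then obtain v' where "v' \<in> opts v" "sub + v' = y + v"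
        using opts_plusI[of sub y v] sub[OF y] xy by auto
      moreover have "sub + (v + U) = y + v" using U(1) by (simp add: ac_simps)
      ultimately have "v + U \<in> opts v" by (metis add_left_cancel)
      then have "unique_factors g"
        using unique_factors_chain4[of U v] x xv no2 U pv by blast
      then show ?thesis ..
    qed
  qed
qed

lemma unique_factors_g: "unique_factors g"
proof (cases "\<exists>r. gprime r \<and> two + r \<in> opts g")
  case True
  then show ?thesis using unique_factors_2 by blast
next
  case False
  show ?thesis
  proof (cases "opts g = {two + sub}")
    case True
    \<comment> \<open>Divisibility is built up along options: \<open>two\<close> yields
      \<open>sub\<close> and \<open>two + two\<close>, and these contain all options of
      \<open>two + sub\<close>.\<close>
    have "part sub g"
      by (rule part_if_opts) (use True g_nonzero part_two_g in \<open>auto simp: opts_sub part_plus\<close>)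
    have "part (two + two) g"
    proof (rule part_if_opts[OF g_nonzero])
      have "two + sub = subq + (two + two)" by (simp add: sub_eq ac_simps)
      then show "part (two + two) x" if "x \<in> opts g" for x
        using that True part_plus(1) by auto
      show "part x g" if "x \<in> opts (two + two)" for x
        using opts_plusD[OF that] part_two_g by (auto simp: opts_two)
    qed
    have "part (two + sub) g"
    proof (rule part_if_opts[OF g_nonzero])
      show "part (two + sub) x" if "x \<in> opts g" for x using that True by simp
      show "part x g" if "x \<in> opts (two + sub)" for x
        using opts_plusD[OF that] \<open>part sub g\<close> \<open>part (two + two) g\<close> by (auto simp: opts_two opts_sub)
    qed
    then show ?thesis
      using unique_factors_if_option_part option_unique True by blast
  next
    case ne: False
    have "opts g \<noteq> {}" using g_nonzero by (simp add: opts_empty_iff)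
    then obtain x where "x \<in> opts g" "x \<noteq> two + sub" using ne by blast
    then show ?thesis using option_cases False by blast
  qed
qed

end

lemma bday_le_6_unique_factors: "bday c \<le> 6 \<Longrightarrow> unique_factors c"
proof (induction "bday c" arbitrary: c rule: less_induct)
  case less
  have IH: "unique_factors x" if "x \<in> opts c" for x
    using less.hyps[of x] bday_opts_less[OF that] less.prems by simp
  consider "c = 0" | "0 \<in> opts c" | p where "p \<in> opts c" "gprime p"
    | "c \<noteq> 0" "\<And>x. x \<in> opts c \<Longrightarrow> composite x"
    by (metis composite_def)
  then show ?case
  proof cases
    case 4
    then interpret day6 c
      by unfold_locales (use less.prems IH in auto)
    show ?thesis by (rule unique_factors_g)
  qed (auto simp: unique_factors_0 intro: zero_option_gprime unique_factors_gprime unique_factors_gprime_option)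
qed

section \<open>From classes back to games: primes, partitions and the unique partition
  property\<close>

lemma is_game_unit_cls: "is_game_unit U \<longleftrightarrow> cls U = 0"
  using cls_eq_iff[of U 0] by (simp add: is_game_unit_iff)

lemma is_part_cls: "is_part H G \<longleftrightarrow> part (cls H) (cls G)"
proof
  assume "is_part H G"
  then obtain X where "G \<doteq> H + X" by (auto simp: is_part_def)
  then have "cls G = cls X + cls H" using cls_eqI cls_plus by (metis add.commute)
  then show "part (cls H) (cls G)" by (auto simp: part_def)
next
  assume "part (cls H) (cls G)"
  then obtain z where "cls G = z + cls H" by (auto simp: part_def)
  then have "cls G = cls (H + rep z)" by (simp add: cls_plus add.commute)
  then obtain u where "G \<doteq> H + rep z + u" by (rule cls_eqE)
  then show "is_part H G" by (auto simp: is_part_def add.assoc)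
qed

lemma prime_game_cls: "prime_game G \<longleftrightarrow> gprime (cls G)"
proof -
  have ex: "(\<exists>H. P (cls H)) \<longleftrightarrow> (\<exists>h. P h)" for P by (metis cls_rep)
  have "prime_game G \<longleftrightarrow> cls G \<noteq> 0 \<and> \<not> (\<exists>h. part h (cls G) \<and> h \<noteq> 0 \<and> h \<noteq> cls G)"
    unfolding prime_game_def is_proper_part_def is_game_unit_cls is_part_cls
      cls_eq_associates[symmetric] cls_zero
    using ex[of "\<lambda>h. part h (cls G) \<and> h \<noteq> 0 \<and> h \<noteq> cls G"] by simp
  also have "\<dots> \<longleftrightarrow> gprime (cls G)"
    unfolding gprime_def part_def by (metis add.left_neutral gclass_self_eq_plus_iff(2))
  finally show ?thesis .
qed

lemma cls_sum_mset: "cls (\<Sum>\<^sub># P) = \<Sum>\<^sub># (image_mset cls P)"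
  by (induction P) (simp_all add: cls_plus)

lemma prime_partition_cls: "prime_partition G P \<longleftrightarrow> factors (cls G) (image_mset cls P)"
  unfolding prime_partition_def factors_def prime_game_cls cls_eq_associates[symmetric] cls_sum_mset
  by auto

lemma UPP_if_unique_factors:
  assumes "unique_factors (cls G)"
  shows "UPP G"
proof -
  obtain F where "factors (cls G) F" using factors_exist by blast
  moreover have "image_mset cls (image_mset rep F) = F" by (simp add: multiset.map_comp o_def)
  ultimately have "prime_partition G (image_mset rep F)" by (simp add: prime_partition_cls)
  moreover have "rel_mset (\<approx>) P Q" if "prime_partition G P" "prime_partition G Q" for P Q
  proof -
    have "image_mset cls P = image_mset cls Q"
      using that assms unique_factorsD by (simp add: prime_partition_cls)
    then have "rel_mset (=) (image_mset cls P) (image_mset cls Q)" by (simp add: multiset.rel_eq)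
    then show ?thesis by (simp add: multiset.rel_map cls_eq_associates)
  qed
  ultimately show ?thesis unfolding UPP_def by blast
qed

theorem theorem7p13:
  fixes G :: game
  assumes "birthday G \<le> 6"
  shows "UPP G"
proof -
  have "\<exists>n H. H \<doteq> G \<and> formal_birthday H = n" using game_eq_refl by blast
  from LeastI_ex[OF this] obtain H where "H \<doteq> G" "formal_birthday H = birthday G"
    unfolding birthday_def by blast
  then have "bday (cls G) \<le> 6" using bday_cls_le[of H] cls_eqI[of H G] assms by simp
  then show ?thesis by (intro UPP_if_unique_factors bday_le_6_unique_factors)
qed

end
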